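(* Every POMDP $\Gamma=(K,A,S,q,g)$ with finitely many states has a general uniform value. That is, there exists $v^*:\Delta(K)\to\mathbb R$ such that for each $\varepsilon>0$ there exist $\alpha>0$ and, for each initial probability $p\in\Delta(K)$, a behavior strategy $\sigma(p)$, with the following property: for every evaluation $\theta$ with $I(\theta)\le\alpha$ and all $p\in\Delta(K)$, - $|v_\theta(p)-v^*(p)|\le\varepsilon$, and - $\gamma_\theta(p,\sigma(p))\ge v^*(p)-\varepsilon$.
   Context: **Model.** A POMDP $\Gamma=(K,A,S,q,g)$ consists of: - a finite state set $K$, - a nonempty action set $A$, - a nonempty signal set $S$, - a transition $q:K\times A\to\Delta_f(S\times K)$, and - a payoff $g:K\times A\to[0,1]$. **Play.** Given an initial $p\in\Delta(K)$, the state $k_1$ is drawn from $p$ and not revealed. At each stage $t$, the player chooses $a_t$ and gets the unobserved payoff $g(k_t,a_t)$; then $(s_t,k_{t+1})$ is drawn from $q(k_t,a_t)$ and only $s_t$ is observed. **Strategies and values.** - A behavior strategy is $\sigma=(\sigma_t)_t$ with $\sigma_t:(A\times S)^{t-1}\to\Delta_f(A)$. - For an evaluation $\theta\in\Delta(\mathbb N^* )$, $\gamma_\theta(p,\sigma)=\mathbb E_{p,\sigma}\sum_t\theta_tg(k_t,a_t)$ and $v_\theta(p)=\sup_\sigma\gamma_\theta(p,\sigma)$. - $I(\theta)=\sum_t|\theta_{t+1}-\theta_t|$. *)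

theory Defs
  imports "HOL-Probability.Probability"
begin

text \<open>POMDP with finite state type 'k, actions 'a, signals 's.
  The transition q k a is a (finitely supported) pmf on signal/next-state pairs,
  the payoff g k a lies in [0,1].  Stages are indexed from 0 here
  (stage t+1 of the paper is index t).\<close>

text \<open>A behaviour strategy: a map from histories (list of past action/signal pairs;
  its length is the number of elapsed stages) to a finitely supported
  distribution over actions.\<close>
definition is_strategy :: "(('a \<times> 's) list \<Rightarrow> 'a pmf) \<Rightarrow> bool" where
  "is_strategy \<sigma> \<longleftrightarrow> (\<forall>h. finite (set_pmf (\<sigma> h)))"

fun state_hist ::
  "('k \<Rightarrow> 'a \<Rightarrow> ('s \<times> 'k) pmf) \<Rightarrow> 'k pmf \<Rightarrow> (('a \<times> 's) list \<Rightarrow> 'a pmf)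
    \<Rightarrow> nat \<Rightarrow> ('k \<times> ('a \<times> 's) list) pmf" where
  "state_hist q p \<sigma> 0 = map_pmf (\<lambda>k. (k, [])) p"
| "state_hist q p \<sigma> (Suc t) =
     bind_pmf (state_hist q p \<sigma> t) (\<lambda>(k, h).
       bind_pmf (\<sigma> h) (\<lambda>a. map_pmf (\<lambda>(s, k'). (k', h @ [(a, s)])) (q k a)))"

definition stage_payoff ::
  "('k \<Rightarrow> 'a \<Rightarrow> ('s \<times> 'k) pmf) \<Rightarrow> ('k \<Rightarrow> 'a \<Rightarrow> real) \<Rightarrow> 'k pmf
    \<Rightarrow> (('a \<times> 's) list \<Rightarrow> 'a pmf) \<Rightarrow> nat \<Rightarrow> real" where
  "stage_payoff q g p \<sigma> t =
     measure_pmf.expectation (state_hist q p \<sigma> t)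
       (\<lambda>(k, h). measure_pmf.expectation (\<sigma> h) (\<lambda>a. g k a))"

definition is_evaluation :: "(nat \<Rightarrow> real) \<Rightarrow> bool" where
  "is_evaluation \<theta> \<longleftrightarrow> (\<forall>t. 0 \<le> \<theta> t) \<and> \<theta> sums 1"

definition TV :: "(nat \<Rightarrow> real) \<Rightarrow> real" where
  "TV \<theta> = (\<Sum>t. \<bar>\<theta> (Suc t) - \<theta> t\<bar>)"

text \<open>gamma_theta(p, sigma) = E sum_t theta_t g(k_t, a_t) = sum_t theta_t E g(k_t,a_t).\<close>
definition gamma ::
  "('k \<Rightarrow> 'a \<Rightarrow> ('s \<times> 'k) pmf) \<Rightarrow> ('k \<Rightarrow> 'a \<Rightarrow> real) \<Rightarrow> (nat \<Rightarrow> real) \<Rightarrow> 'k pmf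
    \<Rightarrow> (('a \<times> 's) list \<Rightarrow> 'a pmf) \<Rightarrow> real" where
  "gamma q g \<theta> p \<sigma> = (\<Sum>t. \<theta> t * stage_payoff q g p \<sigma> t)"

definition val ::
  "('k \<Rightarrow> 'a \<Rightarrow> ('s \<times> 'k) pmf) \<Rightarrow> ('k \<Rightarrow> 'a \<Rightarrow> real) \<Rightarrow> (nat \<Rightarrow> real) \<Rightarrow> 'k pmf \<Rightarrow> real" where
  "val q g \<theta> p = (SUP \<sigma>\<in>{\<sigma>. is_strategy \<sigma>}. gamma q g \<theta> p \<sigma>)"

end

theory Submission
  imports Defs "HOL-Complex_Analysis.Great_Picard"
begin

text \<open>
  Write \<open>V \<theta> x\<close> for the value of the evaluation \<open>\<theta>\<close> at the unnormalised belief \<open>x\<close>. It is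
  homogeneous and 1-Lipschitz in \<open>x\<close>, so the value functions form a totally bounded family.

  Convergence: a uniform limit \<open>v\<close> of \<open>V \<theta>\<^sub>n\<close> with \<open>TV \<theta>\<^sub>n \<longrightarrow> 0\<close> cannot increase in expectation along any
  play. If \<open>TV \<eta>\<close> is small, then \<open>\<eta>\<close> is close to its convolution with a fixed \<open>\<theta>\<^sub>n\<close>, whose payoff
  is an average of delayed \<open>\<theta>\<^sub>n\<close>-payoffs and hence at most about \<open>v\<close>. So any two such limits coincide.

  Uniform strategies: the evaluations with \<open>TV \<theta> \<le> \<alpha>\<close> form a convex set, and a minmax argument on the
  compact space of payoff streams gives one stream \<open>r\<close> in \<open>[0,1]\<close> with \<open>\<langle>\<theta>, r\<rangle> \<le> V \<theta> p\<close> for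
  every \<open>\<theta>\<close> and \<open>\<langle>\<theta>, r\<rangle> \<ge> v p - \<epsilon>\<close> whenever \<open>TV \<theta> \<le> \<alpha>\<close>. The action set is arbitrary, so \<open>r\<close> need
  not be the payoff stream of a strategy; but the domination of \<open>\<langle>\<theta>, r\<rangle>\<close> by the values can be
  preserved from one stage to the next up to arbitrarily small errors, again by a minmax argument, this time
  against a finite net of evaluations. With summable errors this yields a strategy whose payoff at
  every stage is at least that of \<open>r\<close> minus \<open>\<epsilon>\<close>.
\<close>

subsection \<open>A finite minmax alternative\<close>

text \<open>The pairs \<open>(F y, G y)\<close> form a convex planar set that avoids the open
  positive quadrant, so a line through the origin with nonnegative normal \<open>(u, 1 - u)\<close>
  separates the two. The line is built by hand from ratios, since \<open>C\<close> itself carries no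
  linear structure.\<close>

lemma two_functions_alternative:
  fixes F G :: "'c \<Rightarrow> real"
  assumes mix: "\<And>y y' u. y \<in> C \<Longrightarrow> y' \<in> C \<Longrightarrow> 0 \<le> u \<Longrightarrow> u \<le> 1 \<Longrightarrow>
      \<exists>w\<in>C. F w = u * F y + (1 - u) * F y' \<and> G w = u * G y + (1 - u) * G y'"
    and no: "\<And>y. y \<in> C \<Longrightarrow> 0 < F y \<Longrightarrow> G y \<le> 0"
  shows "\<exists>u. 0 \<le> u \<and> u \<le> 1 \<and> (\<forall>y\<in>C. u * F y + (1 - u) * G y \<le> 0)"
proof (cases "(\<exists>y\<in>C. 0 < F y) \<and> (\<exists>y\<in>C. 0 < G y)")
  case False
  then consider "\<forall>y\<in>C. F y \<le> 0" | "\<forall>y\<in>C. G y \<le> 0" by (auto simp: not_less)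
  then show ?thesis
  proof cases
    case 1 then show ?thesis by (intro exI[of _ 1]) auto
  next
    case 2 then show ?thesis by (intro exI[of _ 0]) auto
  qed
next
  case True
  \<comment> \<open>Otherwise the segment joining the two image points would meet the open positive
    quadrant.\<close>
  have cross: "F y * G y' \<le> F y' * G y"
    if y: "y \<in> C" "0 < F y" and y': "y' \<in> C" "0 < G y'" for y y'
  proof (rule ccontr)
    assume gt: "\<not> F y * G y' \<le> F y' * G y"
    define a b c d where "a = F y" and "b = - G y" and "c = G y'" and "d = - F y'"
    have pos: "0 < a" "0 \<le> b" "0 < c" "0 \<le> d"
      using y y' no[of y] no[of y'] by (force simp: a_def b_def c_def d_def)+
    have gt': "0 < a * c - b * d" using gt by (simp add: a_def b_def c_def d_def algebra_simps)
    define s where "s = a + b + c + d"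
    have s: "0 < s" using pos by (simp add: s_def)
    \<comment> \<open>This weight places the mixture on the diagonal
      \<open>F w = G w\<close>.\<close>
    define u where "u = (d + c) / s"
    have u: "0 \<le> u" "u \<le> 1" "1 - u = (a + b) / s"
      using pos s by (auto simp: u_def s_def field_simps)
    obtain w where w: "w \<in> C" "F w = u * F y + (1 - u) * F y'" "G w = u * G y + (1 - u) * G y'"
      using mix[OF y(1) y'(1) u(1,2)] by blast
    have "F w = (a * c - b * d) / s" "G w = (a * c - b * d) / s"
      unfolding w u(3) unfolding u_def a_def b_def c_def d_def
      by (simp_all add: algebra_simps add_divide_distrib diff_divide_distrib)
    then have "0 < F w" "0 < G w" using gt' s by auto
    then show False using no[OF w(1)] by simp
  qed
  \<comment> \<open>Points with \<open>0 < F\<close> have ratio \<open>F / - G\<close>, points with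
    \<open>0 < G\<close> have ratio \<open>- F / G\<close>. By \<open>cross\<close> the former never
    exceed the latter, so the supremum \<rho> of the former separates the two families.\<close>
  define Q where "Q = (\<lambda>y. F y / - G y) ` {y\<in>C. 0 < F y}"
  obtain y1 where y1: "y1 \<in> C" "0 < F y1" using True by blast
  obtain y2 where y2: "y2 \<in> C" "0 < G y2" using True by blast
  have Gneg: "G y < 0" if "y \<in> C" "0 < F y" for y
  proof (rule ccontr)
    assume "\<not> G y < 0"
    then have "G y = 0" using no[OF that] by simp
    then have "F y * G y2 \<le> 0" using cross[OF that y2] by simp
    then show False using that y2 by (simp add: mult_le_0_iff)
  qed
  have Qle: "z \<le> - F y / G y" if "z \<in> Q" "y \<in> C" "0 < G y" for z y
  proof -
    obtain x where x: "x \<in> C" "0 < F x" "z = F x / - G x" using \<open>z \<in> Q\<close> by (auto simp: Q_def)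
    show ?thesis unfolding x(3) using cross[OF x(1,2) that(2,3)] Gneg[OF x(1,2)] that(3)
      by (simp add: field_simps)
  qed
  have bdd: "bdd_above Q" using Qle[OF _ y2] by (auto simp: bdd_above_def)
  define \<rho> where "\<rho> = Sup Q"
  have up: "F y / - G y \<le> \<rho>" if "y \<in> C" "0 < F y" for y
    unfolding \<rho>_def using that by (intro cSup_upper bdd) (auto simp: Q_def)
  have lo: "\<rho> \<le> - F y / G y" if "y \<in> C" "0 < G y" for y
    unfolding \<rho>_def using y1 Qle[OF _ that] by (intro cSup_least) (auto simp: Q_def)
  have \<rho>0: "0 \<le> \<rho>" using up[OF y1] Gneg[OF y1] y1
    by (smt (verit) divide_nonneg_pos)
  have key: "F y + \<rho> * G y \<le> 0" if "y \<in> C" for y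
  proof -
    consider "0 < F y" | "0 < G y" | "F y \<le> 0" "G y \<le> 0" by linarith
    then show ?thesis
    proof cases
      case 1 then show ?thesis using up[OF that 1] Gneg[OF that 1] by (simp add: field_simps)
    next
      case 2 then show ?thesis using lo[OF that 2] by (simp add: field_simps)
    next
      case 3 then show ?thesis using \<rho>0 by (simp add: add_nonpos_nonpos mult_nonneg_nonpos)
    qed
  qed
  have "1 / (1 + \<rho>) * F y + (1 - 1 / (1 + \<rho>)) * G y \<le> 0" if "y \<in> C" for y
  proof -
    have "1 - 1 / (1 + \<rho>) = \<rho> / (1 + \<rho>)" using \<rho>0 by (simp add: field_simps)
    then have "1 / (1 + \<rho>) * F y + (1 - 1 / (1 + \<rho>)) * G y = (F y + \<rho> * G y) / (1 + \<rho>)"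
      by (simp add: add_divide_distrib)
    then show ?thesis using key[OF that] \<rho>0 by (simp add: divide_nonpos_pos)
  qed
  then show ?thesis using \<rho>0 by (intro exI[of _ "1 / (1 + \<rho>)"]) auto
qed

text \<open>\<open>C\<close> needs no linear structure, which allows \<open>C\<close> to consist of families of lotteries.\<close>
lemma finite_minmax_alternative:
  fixes f :: "'i \<Rightarrow> 'c \<Rightarrow> real"
  assumes "finite I" "I \<noteq> {}"
    and "\<And>y y' u. y \<in> C \<Longrightarrow> y' \<in> C \<Longrightarrow> 0 \<le> u \<Longrightarrow> u \<le> 1 \<Longrightarrow>
      \<exists>w\<in>C. \<forall>i\<in>I. f i w = u * f i y + (1 - u) * f i y'"
    and "\<not> (\<exists>y\<in>C. \<forall>i\<in>I. 0 < f i y)"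
  shows "\<exists>\<mu>. (\<forall>i\<in>I. 0 \<le> \<mu> i) \<and> sum \<mu> I = 1 \<and> (\<forall>y\<in>C. (\<Sum>i\<in>I. \<mu> i * f i y) \<le> 0)"
  using assms
proof (induction I arbitrary: C rule: finite_ne_induct)
  case (singleton i)
  then show ?case by (intro exI[of _ "\<lambda>_. 1"]) (auto simp: not_less)
next
  case (insert j I)
  \<comment> \<open>Where \<open>f j\<close> is positive, the induction hypothesis combines the
    other functions into one function \<open>F\<close> that is nonpositive there. The two-function
    case then applies to \<open>f j\<close> and \<open>F\<close> on all of \<open>C\<close>.\<close>
  define C' where "C' = {y\<in>C. 0 < f j y}"
  have "\<exists>w\<in>C'. \<forall>i\<in>I. f i w = u * f i y + (1 - u) * f i y'"
    if yy: "y \<in> C'" "y' \<in> C'" and u: "0 \<le> u" "u \<le> 1" for y y' u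
  proof -
    obtain w where w: "w \<in> C" "\<forall>i\<in>insert j I. f i w = u * f i y + (1 - u) * f i y'"
      using insert.prems(1)[of y y' u] yy u unfolding C'_def by blast
    have "0 < u * f j y + (1 - u) * f j y'"
      using yy u unfolding C'_def
      by (cases "u = 0") (auto intro!: add_pos_nonneg mult_nonneg_nonneg)
    then show ?thesis using w by (intro bexI[of _ w]) (auto simp: C'_def)
  qed
  moreover have "\<not> (\<exists>y\<in>C'. \<forall>i\<in>I. 0 < f i y)" using insert.prems(2) by (auto simp: C'_def)
  ultimately obtain \<mu> where \<mu>: "\<forall>i\<in>I. 0 \<le> \<mu> i" "sum \<mu> I = 1" "\<forall>y\<in>C'. (\<Sum>i\<in>I. \<mu> i * f i y) \<le> 0"
    using insert.IH[of C'] by blast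
  define F where "F y = (\<Sum>i\<in>I. \<mu> i * f i y)" for y
  have "\<exists>u. 0 \<le> u \<and> u \<le> 1 \<and> (\<forall>y\<in>C. u * f j y + (1 - u) * F y \<le> 0)"
  proof (rule two_functions_alternative)
    show "F y \<le> 0" if "y \<in> C" "0 < f j y" for y using \<mu>(3) that by (simp add: C'_def F_def)
    show "\<exists>w\<in>C. f j w = u * f j y + (1 - u) * f j y' \<and> F w = u * F y + (1 - u) * F y'"
      if yy: "y \<in> C" "y' \<in> C" "0 \<le> u" "u \<le> 1" for y y' u
    proof -
      obtain w where w: "w \<in> C" "\<forall>i\<in>insert j I. f i w = u * f i y + (1 - u) * f i y'"
        using insert.prems(1)[OF yy] by blast
      have "F w = u * F y + (1 - u) * F y'"
      proof -
        have "F w = (\<Sum>i\<in>I. \<mu> i * (u * f i y + (1 - u) * f i y'))"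
          unfolding F_def using w(2) by (intro sum.cong) auto
        then show ?thesis
          by (simp add: F_def sum_distrib_left sum.distrib[symmetric] algebra_simps)
      qed
      then show ?thesis using w by blast
    qed
  qed
  then obtain u where u: "0 \<le> u" "u \<le> 1" "\<forall>y\<in>C. u * f j y + (1 - u) * F y \<le> 0" by blast
  let ?\<mu> = "\<lambda>i. if i = j then u else (1 - u) * \<mu> i"
  have rest: "(\<Sum>i\<in>I. ?\<mu> i * h i) = (1 - u) * (\<Sum>i\<in>I. \<mu> i * h i)" for h :: "'i \<Rightarrow> real"
    unfolding sum_distrib_left using insert.hyps by (intro sum.cong) auto
  have "sum ?\<mu> (insert j I) = 1"
    using rest[of "\<lambda>_. 1"] insert.hyps \<mu>(2) by simp
  moreover have "(\<Sum>i\<in>insert j I. ?\<mu> i * f i y) = u * f j y + (1 - u) * F y" for y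
    using rest[of "\<lambda>i. f i y"] insert.hyps by (simp add: F_def)
  ultimately show ?case using u \<mu>(1) by (intro exI[of _ ?\<mu>]) auto
qed

subsection \<open>Evaluations\<close>

lemma evaluation_summable: "is_evaluation \<theta> \<Longrightarrow> summable \<theta>"
  and evaluation_nonneg: "is_evaluation \<theta> \<Longrightarrow> 0 \<le> \<theta> t"
  and evaluation_suminf: "is_evaluation \<theta> \<Longrightarrow> suminf \<theta> = 1"
  by (auto simp: is_evaluation_def sums_iff)

lemma evaluation_summable_mult:
  assumes "is_evaluation \<theta>" "\<And>t. \<bar>\<rho> t\<bar> \<le> B"
  shows "summable (\<lambda>t. \<theta> t * \<rho> t)"
proof (rule summable_comparison_test')
  show "summable (\<lambda>t. \<theta> t * B)" by (intro summable_mult2 evaluation_summable assms)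
  show "norm (\<theta> t * \<rho> t) \<le> \<theta> t * B" for t
    using assms evaluation_nonneg[of \<theta> t] by (simp add: abs_mult mult_left_mono)
qed

lemma evaluation_suminf_mult_le:
  assumes "is_evaluation \<theta>" "\<And>t. \<bar>\<rho> t\<bar> \<le> B" "\<And>t. \<rho> t \<le> c"
  shows "(\<Sum>t. \<theta> t * \<rho> t) \<le> c"
proof -
  have "(\<Sum>t. \<theta> t * \<rho> t) \<le> (\<Sum>t. \<theta> t * c)"
    using assms evaluation_nonneg[of \<theta>]
    by (intro suminf_le evaluation_summable_mult[of \<theta> \<rho> B] summable_mult2 evaluation_summable)
      (auto intro: mult_left_mono)
  also have "\<dots> = c"
    using suminf_mult2[OF evaluation_summable[OF assms(1)], of c] evaluation_suminf[OF assms(1)] by simp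
  finally show ?thesis .
qed

lemma evaluation_variation_summable:
  assumes "is_evaluation \<theta>" shows "summable (\<lambda>t. \<bar>\<theta> (Suc t) - \<theta> t\<bar>)"
proof (rule summable_comparison_test')
  show "summable (\<lambda>t. \<theta> (Suc t) + \<theta> t)"
    using evaluation_summable[OF assms] by (intro summable_add) (auto simp: summable_Suc_iff)
  show "norm \<bar>\<theta> (Suc t) - \<theta> t\<bar> \<le> \<theta> (Suc t) + \<theta> t" for t
    using evaluation_nonneg[OF assms, of t] evaluation_nonneg[OF assms, of "Suc t"] by simp
qed

text \<open>An evaluation tends to 0, so its first weight is the sum of its successive
  decrements.\<close>

lemma evaluation_first_le_TV:
  assumes "is_evaluation \<theta>" shows "\<theta> 0 \<le> TV \<theta>"
proof -
  have lim: "\<theta> \<longlonglongrightarrow> 0" using assms by (intro summable_LIMSEQ_zero evaluation_summable)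
  have "(\<lambda>t. \<theta> (Suc t) - \<theta> t) sums (0 - \<theta> 0)" by (rule telescope_sums[OF lim])
  then have "(\<lambda>t. \<theta> t - \<theta> (Suc t)) sums \<theta> 0" using sums_minus by fastforce
  moreover have "(\<Sum>t. \<theta> t - \<theta> (Suc t)) \<le> (\<Sum>t. \<bar>\<theta> (Suc t) - \<theta> t\<bar>)"
    using calculation evaluation_variation_summable[OF assms]
    by (intro suminf_le) (auto simp: sums_iff)
  ultimately show ?thesis by (simp add: TV_def sums_iff)
qed

lemma TV_nonneg: "is_evaluation \<theta> \<Longrightarrow> 0 \<le> TV \<theta>"
  using evaluation_first_le_TV evaluation_nonneg order_trans by blast

text \<open>Summation by parts moves the shift from \<rho> to \<theta>. This leaves the increments
  of \<theta>, worth at most \<open>TV \<theta> * B\<close>, and the boundary term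
  \<open>\<theta> 0 * \<rho> 0\<close>, which obeys the same bound by
  \<open>evaluation_first_le_TV\<close>; hence the factor 2.\<close>

lemma evaluation_shift_bound:
  assumes \<theta>: "is_evaluation \<theta>" and \<rho>: "\<And>t. \<bar>\<rho> t\<bar> \<le> B"
  shows "\<bar>(\<Sum>t. \<theta> t * \<rho> (Suc t)) - (\<Sum>t. \<theta> t * \<rho> t)\<bar> \<le> 2 * B * TV \<theta>"
proof -
  have B: "0 \<le> B" using \<rho>[of 0] by simp
  note sm = evaluation_summable_mult[OF \<theta>, of \<rho> B] evaluation_summable_mult[OF \<theta>, of "\<lambda>t. \<rho> (Suc t)" B]
  have s1: "summable (\<lambda>t. \<theta> t * \<rho> t)" "summable (\<lambda>t. \<theta> t * \<rho> (Suc t))" using sm \<rho> by auto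
  have s2: "summable (\<lambda>t. \<theta> (Suc t) * \<rho> (Suc t))"
    using s1(1) summable_Suc_iff[of "\<lambda>t. \<theta> t * \<rho> t"] by simp
  have "(\<Sum>t. \<theta> t * \<rho> t) = \<theta> 0 * \<rho> 0 + (\<Sum>t. \<theta> (Suc t) * \<rho> (Suc t))"
    using suminf_split_head[OF s1(1)] by simp
  then have eq: "(\<Sum>t. \<theta> t * \<rho> (Suc t)) - (\<Sum>t. \<theta> t * \<rho> t) =
      (\<Sum>t. \<theta> t * \<rho> (Suc t) - \<theta> (Suc t) * \<rho> (Suc t)) - \<theta> 0 * \<rho> 0"
    using suminf_diff[OF s1(2) s2] by simp
  have v: "summable (\<lambda>t. \<bar>\<theta> (Suc t) - \<theta> t\<bar> * B)"
    by (intro summable_mult2 evaluation_variation_summable \<theta>)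
  have "norm (\<Sum>t. \<theta> t * \<rho> (Suc t) - \<theta> (Suc t) * \<rho> (Suc t)) \<le> (\<Sum>t. \<bar>\<theta> (Suc t) - \<theta> t\<bar> * B)"
  proof (rule norm_suminf_le[OF _ v])
    fix t
    have "\<theta> t * \<rho> (Suc t) - \<theta> (Suc t) * \<rho> (Suc t) = (\<theta> t - \<theta> (Suc t)) * \<rho> (Suc t)"
      by (simp add: algebra_simps)
    then show "norm (\<theta> t * \<rho> (Suc t) - \<theta> (Suc t) * \<rho> (Suc t)) \<le> \<bar>\<theta> (Suc t) - \<theta> t\<bar> * B"
      using \<rho>[of "Suc t"] by (simp add: abs_mult abs_minus_commute mult_left_mono)
  qed
  also have "\<dots> = TV \<theta> * B"
    unfolding TV_def using evaluation_variation_summable[OF \<theta>] by (simp add: suminf_mult2)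
  finally have 1: "\<bar>\<Sum>t. \<theta> t * \<rho> (Suc t) - \<theta> (Suc t) * \<rho> (Suc t)\<bar> \<le> TV \<theta> * B" by simp
  have "\<bar>\<theta> 0 * \<rho> 0\<bar> \<le> TV \<theta> * B"
    unfolding abs_mult using evaluation_first_le_TV[OF \<theta>] evaluation_nonneg[OF \<theta>, of 0] \<rho>[of 0] B
    by (intro mult_mono) auto
  moreover have "2 * B * TV \<theta> = TV \<theta> * B + TV \<theta> * B" by simp
  ultimately show ?thesis using 1 unfolding eq by linarith
qed

lemma evaluation_delay_bound:
  assumes \<theta>: "is_evaluation \<theta>" and \<rho>: "\<And>t. \<bar>\<rho> t\<bar> \<le> B"
  shows "\<bar>(\<Sum>t. \<theta> t * \<rho> (t + j)) - (\<Sum>t. \<theta> t * \<rho> t)\<bar> \<le> 2 * real j * B * TV \<theta>"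
proof (induction j)
  case (Suc j)
  have "\<bar>(\<Sum>t. \<theta> t * \<rho> (t + Suc j)) - (\<Sum>t. \<theta> t * \<rho> (t + j))\<bar> \<le> 2 * B * TV \<theta>"
    using evaluation_shift_bound[OF \<theta>, of "\<lambda>t. \<rho> (t + j)" B] \<rho> by simp
  then show ?case using Suc by (simp add: algebra_simps)
qed simp

lemma evaluation_convex_sum:
  assumes "finite I" "\<And>i. i \<in> I \<Longrightarrow> is_evaluation (\<theta> i)" "\<And>i. i \<in> I \<Longrightarrow> 0 \<le> \<mu> i" "sum \<mu> I = 1"
  shows "is_evaluation (\<lambda>t. \<Sum>i\<in>I. \<mu> i * \<theta> i t)"
proof -
  have "(\<lambda>t. \<Sum>i\<in>I. \<mu> i * \<theta> i t) sums (\<Sum>i\<in>I. \<mu> i * 1)"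
    using assms(2) by (intro sums_sum sums_mult) (auto simp: is_evaluation_def)
  moreover have "0 \<le> (\<Sum>i\<in>I. \<mu> i * \<theta> i t)" for t
    using assms evaluation_nonneg by (intro sum_nonneg mult_nonneg_nonneg) auto
  ultimately show ?thesis using assms(4) by (simp add: is_evaluation_def)
qed

text \<open>Lets a finite mixture of constraints given by slowly varying evaluations be read as one
  constraint of the same kind.\<close>

lemma TV_convex_sum_le:
  assumes "finite I" "\<And>i. i \<in> I \<Longrightarrow> is_evaluation (\<theta> i)" "\<And>i. i \<in> I \<Longrightarrow> 0 \<le> \<mu> i" "sum \<mu> I = 1"
    and "\<And>i. i \<in> I \<Longrightarrow> TV (\<theta> i) \<le> \<alpha>"
  shows "TV (\<lambda>t. \<Sum>i\<in>I. \<mu> i * \<theta> i t) \<le> \<alpha>"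
proof -
  let ?\<xi> = "\<lambda>t. \<Sum>i\<in>I. \<mu> i * \<theta> i t"
  let ?b = "\<lambda>t. \<Sum>i\<in>I. \<mu> i * \<bar>\<theta> i (Suc t) - \<theta> i t\<bar>"
  have s: "summable (\<lambda>t. \<mu> i * \<bar>\<theta> i (Suc t) - \<theta> i t\<bar>)" if "i \<in> I" for i
    using evaluation_variation_summable[OF assms(2)[OF that]] by (rule summable_mult)
  have "TV ?\<xi> \<le> suminf ?b"
    unfolding TV_def
  proof (rule suminf_le)
    show "summable (\<lambda>t. \<bar>?\<xi> (Suc t) - ?\<xi> t\<bar>)"
      by (intro evaluation_variation_summable evaluation_convex_sum assms)
    show "summable ?b" by (intro summable_sum s)
    show "\<bar>?\<xi> (Suc t) - ?\<xi> t\<bar> \<le> ?b t" for t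
    proof -
      have "\<bar>?\<xi> (Suc t) - ?\<xi> t\<bar> = \<bar>\<Sum>i\<in>I. \<mu> i * (\<theta> i (Suc t) - \<theta> i t)\<bar>"
        by (simp add: sum_subtractf[symmetric] algebra_simps)
      also have "\<dots> \<le> ?b t"
        using assms(3) by (intro order_trans[OF sum_abs] sum_mono) (auto simp: abs_mult)
      finally show ?thesis .
    qed
  qed
  also have "\<dots> = (\<Sum>i\<in>I. \<Sum>t. \<mu> i * \<bar>\<theta> i (Suc t) - \<theta> i t\<bar>)" by (rule suminf_sum[OF s])
  also have "\<dots> = (\<Sum>i\<in>I. \<mu> i * TV (\<theta> i))"
    unfolding TV_def
    by (intro sum.cong refl suminf_mult evaluation_variation_summable assms(2))
  also have "\<dots> \<le> (\<Sum>i\<in>I. \<mu> i * \<alpha>)" using assms(3,5) by (intro sum_mono mult_left_mono) auto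
  also have "\<dots> = \<alpha>" using assms(4) by (simp add: sum_distrib_right[symmetric])
  finally show ?thesis .
qed

section \<open>Cesaro averages, delayed mixtures and the topology of payoff streams\<close>

definition uniform_evaluation :: "nat \<Rightarrow> nat \<Rightarrow> real" where
  "uniform_evaluation n t = (if t \<le> n then 1 / real (Suc n) else 0)"

lemma is_evaluation_uniform: "is_evaluation (uniform_evaluation n)"
proof -
  have "uniform_evaluation n sums (\<Sum>t\<in>{..n}. uniform_evaluation n t)"
    by (rule sums_finite) (auto simp: uniform_evaluation_def)
  then show ?thesis by (simp add: is_evaluation_def uniform_evaluation_def)
qed

text \<open>Only the drop after stage \<open>n\<close> counts, as \<open>TV\<close> begins with the
  difference between the first two weights. The Cesaro averages thus supply evaluations of vanishing
  variation.\<close>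

lemma TV_uniform: "TV (uniform_evaluation n) = 1 / real (Suc n)"
proof -
  have "TV (uniform_evaluation n) =
      (\<Sum>t\<in>{n}. \<bar>uniform_evaluation n (Suc t) - uniform_evaluation n t\<bar>)"
    unfolding TV_def by (rule suminf_finite) (auto simp: uniform_evaluation_def)
  then show ?thesis by (simp add: uniform_evaluation_def)
qed

text \<open>Weight \<open>m\<close> on the current stage, the rest shared among the members of
  \<open>F\<close> delayed by one stage: the form that a mixture of one-step constraints
  takes.\<close>

lemma is_evaluation_case_nat:
  assumes "finite F" "\<And>\<theta>. \<theta> \<in> F \<Longrightarrow> is_evaluation \<theta>" "\<And>\<theta>. \<theta> \<in> F \<Longrightarrow> 0 \<le> \<mu> \<theta>" "0 \<le> m"
    and "m + sum \<mu> F = 1"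
  shows "is_evaluation (case_nat m (\<lambda>t. \<Sum>\<theta>\<in>F. \<mu> \<theta> * \<theta> t))"
proof -
  have "(\<lambda>t. \<Sum>\<theta>\<in>F. \<mu> \<theta> * \<theta> t) sums (\<Sum>\<theta>\<in>F. \<mu> \<theta> * 1)"
    using assms(2) by (intro sums_sum sums_mult) (auto simp: is_evaluation_def)
  then have "case_nat m (\<lambda>t. \<Sum>\<theta>\<in>F. \<mu> \<theta> * \<theta> t) sums (sum \<mu> F + m)"
    using sums_Suc_iff[of "case_nat m (\<lambda>t. \<Sum>\<theta>\<in>F. \<mu> \<theta> * \<theta> t)" "sum \<mu> F"] by simp
  moreover have "0 \<le> case_nat m (\<lambda>t. \<Sum>\<theta>\<in>F. \<mu> \<theta> * \<theta> t) t" for t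
    using assms evaluation_nonneg by (cases t) (auto intro!: sum_nonneg)
  ultimately show ?thesis using assms(5) by (simp add: is_evaluation_def add.commute)
qed

lemma suminf_case_nat_evaluation:
  assumes "finite F" "\<And>\<theta>. \<theta> \<in> F \<Longrightarrow> is_evaluation \<theta>" "\<And>t. \<bar>\<rho> t\<bar> \<le> B"
  shows "(\<Sum>t. case_nat m (\<lambda>t. \<Sum>\<theta>\<in>F. \<mu> \<theta> * \<theta> t) t * \<rho> t) =
    m * \<rho> 0 + (\<Sum>\<theta>\<in>F. \<mu> \<theta> * (\<Sum>t. \<theta> t * \<rho> (Suc t)))"
proof -
  let ?\<xi> = "case_nat m (\<lambda>t. \<Sum>\<theta>\<in>F. \<mu> \<theta> * \<theta> t)"
  have s: "summable (\<lambda>t. \<theta> t * \<rho> (Suc t))" if "\<theta> \<in> F" for \<theta>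
    using evaluation_summable_mult[OF assms(2)[OF that], of "\<lambda>t. \<rho> (Suc t)" B] assms(3) by simp
  have eq: "?\<xi> (Suc t) * \<rho> (Suc t) = (\<Sum>\<theta>\<in>F. \<mu> \<theta> * (\<theta> t * \<rho> (Suc t)))" for t
    by (simp add: sum_distrib_right mult.assoc)
  have "summable (\<lambda>t. ?\<xi> (Suc t) * \<rho> (Suc t))"
    unfolding eq by (intro summable_sum summable_mult s)
  then have "summable (\<lambda>t. ?\<xi> t * \<rho> t)" using summable_Suc_iff[of "\<lambda>t. ?\<xi> t * \<rho> t"] by simp
  then have "(\<Sum>t. ?\<xi> t * \<rho> t) = m * \<rho> 0 + (\<Sum>t. ?\<xi> (Suc t) * \<rho> (Suc t))"
    using suminf_split_head[of "\<lambda>t. ?\<xi> t * \<rho> t"] by simp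
  also have "(\<Sum>t. ?\<xi> (Suc t) * \<rho> (Suc t)) = (\<Sum>\<theta>\<in>F. \<Sum>t. \<mu> \<theta> * (\<theta> t * \<rho> (Suc t)))"
    unfolding eq by (intro suminf_sum summable_mult s)
  also have "\<dots> = (\<Sum>\<theta>\<in>F. \<mu> \<theta> * (\<Sum>t. \<theta> t * \<rho> (Suc t)))"
    by (intro sum.cong refl suminf_mult s)
  finally show ?thesis .
qed

text \<open>Streams carry the product topology, in which finite partial sums are continuous. On the
  box these converge uniformly, with the weights of \<theta> as majorants.\<close>

lemma continuous_on_evaluation:
  assumes "is_evaluation \<theta>"
  shows "continuous_on (UNIV \<rightarrow> {0..1}) (\<lambda>r :: nat \<Rightarrow> real. \<Sum>t. \<theta> t * r t)"
proof (rule uniform_limit_theorem[OF _ Weierstrass_m_test])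
  show "norm (\<theta> t * r t) \<le> \<theta> t" if "r \<in> UNIV \<rightarrow> {0..1}" for t r
    using that evaluation_nonneg[OF assms, of t] by (auto simp: abs_mult Pi_iff mult_left_le)
  show "\<forall>\<^sub>F n in sequentially. continuous_on (UNIV \<rightarrow> {0..1}) (\<lambda>r :: nat \<Rightarrow> real. \<Sum>i<n. \<theta> i * r i)"
    by (intro always_eventually allI continuous_intros
        continuous_on_subset[OF continuous_on_product_coordinates subset_UNIV])
qed (auto intro: evaluation_summable[OF assms])

text \<open>Tychonoff's theorem, transferred from the abstract product topology to the type class
  topology on functions.\<close>

lemma compact_box: "compact (UNIV \<rightarrow> {0..1} :: (nat \<Rightarrow> real) set)"
proof -
  have "compactin (product_topology (\<lambda>_::nat. euclidean :: real topology) UNIV) (PiE UNIV (\<lambda>_. {0..1}))"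
    unfolding compactin_PiE by auto
  then show ?thesis by (simp add: euclidean_product_topology PiE_UNIV_domain)
qed

subsection \<open>Values at unnormalised beliefs\<close>

lemma expectation_mixture:
  fixes f :: "'c \<Rightarrow> real"
  assumes "finite (set_pmf P)" "finite (set_pmf Q)" "0 \<le> u" "u \<le> 1"
  shows "measure_pmf.expectation (bind_pmf (bernoulli_pmf u) (\<lambda>b. if b then P else Q)) f =
    u * measure_pmf.expectation P f + (1 - u) * measure_pmf.expectation Q f"
  using assms by (subst pmf_expectation_bind[of UNIV]) (auto simp: UNIV_bool)

locale pomdp =
  fixes q :: "'k::finite \<Rightarrow> 'a \<Rightarrow> ('s \<times> 'k) pmf" and g :: "'k \<Rightarrow> 'a \<Rightarrow> real"
  assumes finite_q: "finite (set_pmf (q k a))"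
    and g_nonneg: "0 \<le> g k a" and g_le_1: "g k a \<le> 1"
begin

definition reward :: "(('a \<times> 's) list \<Rightarrow> 'a pmf) \<Rightarrow> nat \<Rightarrow> 'k \<Rightarrow> real" where
  "reward \<sigma> t k = stage_payoff q g (return_pmf k) \<sigma> t"

definition continuation ::
  "(('a \<times> 's) list \<Rightarrow> 'a pmf) \<Rightarrow> 'a \<Rightarrow> 's \<Rightarrow> ('a \<times> 's) list \<Rightarrow> 'a pmf" where
  "continuation \<sigma> a s h = \<sigma> ((a, s) # h)"

text \<open>The union over all states makes the range of a signal sum independent of the state, so
  it can be exchanged with sums over states.\<close>

definition signals :: "'a \<Rightarrow> 's set" where
  "signals a = (\<Union>k. fst ` set_pmf (q k a))"

text \<open>Beliefs are not renormalised after an action \<open>a\<close> and a signal \<open>s\<close>: the probability of \<open>s\<close>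
  stays in the mass of the vector, and the homogeneity of \<open>V\<close> accounts for it.\<close>
definition push :: "'a \<Rightarrow> 's \<Rightarrow> real ^ 'k \<Rightarrow> real ^ 'k" where
  "push a s x = (\<chi> k'. \<Sum>k\<in>UNIV. x $ k * pmf (q k a) (s, k'))"

definition mass :: "real ^ 'k \<Rightarrow> real" where
  "mass x = (\<Sum>k\<in>UNIV. x $ k)"

definition orthant :: "(real ^ 'k) set" where
  "orthant = {x. \<forall>k. 0 \<le> x $ k}"

text \<open>Linear on the whole vector space, so that differences of beliefs may be inserted as
  well.\<close>

definition reward_vec :: "(('a \<times> 's) list \<Rightarrow> 'a pmf) \<Rightarrow> nat \<Rightarrow> real ^ 'k \<Rightarrow> real" where
  "reward_vec \<sigma> t x = (\<Sum>k\<in>UNIV. x $ k * reward \<sigma> t k)"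

text \<open>The first \<open>j\<close> stages are played by the same strategy but earn nothing; the
  weights \<theta> begin to count afterwards.\<close>

definition delayed_payoff ::
  "nat \<Rightarrow> (nat \<Rightarrow> real) \<Rightarrow> (('a \<times> 's) list \<Rightarrow> 'a pmf) \<Rightarrow> real ^ 'k \<Rightarrow> real" where
  "delayed_payoff j \<theta> \<sigma> x = (\<Sum>t. \<theta> t * reward_vec \<sigma> (t + j) x)"

abbreviation payoff :: "(nat \<Rightarrow> real) \<Rightarrow> (('a \<times> 's) list \<Rightarrow> 'a pmf) \<Rightarrow> real ^ 'k \<Rightarrow> real" where
  "payoff \<equiv> delayed_payoff 0"

definition V :: "(nat \<Rightarrow> real) \<Rightarrow> real ^ 'k \<Rightarrow> real" where
  "V \<theta> x = (SUP \<sigma>\<in>{\<sigma>. is_strategy \<sigma>}. payoff \<theta> \<sigma> x)"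

section \<open>First-step decomposition of play\<close>

lemma finite_set_state_hist:
  "is_strategy \<sigma> \<Longrightarrow> finite (set_pmf (state_hist q p \<sigma> t))"
  by (induction t) (auto simp: is_strategy_def finite_q)

lemma state_hist_mixture:
  "state_hist q p \<sigma> t = bind_pmf p (\<lambda>k. state_hist q (return_pmf k) \<sigma> t)"
proof (induction t)
  case 0
  show ?case by (simp add: map_pmf_def bind_return_pmf)
next
  case (Suc t)
  show ?case by (simp only: state_hist.simps Suc bind_assoc_pmf)
qed

lemma stage_payoff_mixture:
  assumes "is_strategy \<sigma>"
  shows "stage_payoff q g p \<sigma> t = (\<Sum>k\<in>UNIV. pmf p k * reward \<sigma> t k)"
  unfolding stage_payoff_def reward_def
  by (subst state_hist_mixture, subst pmf_expectation_bind[of UNIV])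
    (auto simp: finite_set_state_hist[OF assms])

text \<open>\<open>state_hist\<close> grows at its last stage, whereas dynamic programming splits
  off the first one. The induction carries the first step through the defining recursion.\<close>

lemma state_hist_Suc_first_step:
  "state_hist q (return_pmf k) \<sigma> (Suc t) =
     bind_pmf (\<sigma> []) (\<lambda>a. bind_pmf (q k a) (\<lambda>(s, k').
       map_pmf (\<lambda>(k'', h). (k'', (a, s) # h)) (state_hist q (return_pmf k') (continuation \<sigma> a s) t)))"
proof (induction t)
  case 0
  show ?case
    by (simp add: map_pmf_def bind_return_pmf bind_assoc_pmf case_prod_unfold)
next
  case (Suc t)
  have "state_hist q (return_pmf k) \<sigma> (Suc (Suc t)) =
     bind_pmf (state_hist q (return_pmf k) \<sigma> (Suc t)) (\<lambda>(k, h).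
       bind_pmf (\<sigma> h) (\<lambda>a. map_pmf (\<lambda>(s, k'). (k', h @ [(a, s)])) (q k a)))"
    by simp
  then show ?case
    unfolding Suc
    by (simp add: map_pmf_def bind_return_pmf bind_assoc_pmf case_prod_unfold continuation_def[abs_def])
qed

lemma is_strategy_continuation: "is_strategy \<sigma> \<Longrightarrow> is_strategy (continuation \<sigma> a s)"
  by (simp add: is_strategy_def continuation_def)

lemma finite_strategy: "is_strategy \<sigma> \<Longrightarrow> finite (set_pmf (\<sigma> h))"
  by (simp add: is_strategy_def)

lemma finite_signals: "finite (signals a)"
  by (simp add: signals_def finite_q)

lemma sum_transition:
  "(\<Sum>z\<in>set_pmf (q k a). pmf (q k a) z * f z) =
   (\<Sum>s\<in>signals a. \<Sum>k'\<in>UNIV. pmf (q k a) (s, k') * f (s, k'))"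
proof -
  have "(\<Sum>z\<in>set_pmf (q k a). pmf (q k a) z * f z) = (\<Sum>z\<in>signals a \<times> UNIV. pmf (q k a) z * f z)"
  proof (rule sum.mono_neutral_left)
    show "set_pmf (q k a) \<subseteq> signals a \<times> UNIV" unfolding signals_def by force
  qed (auto simp: finite_signals set_pmf_iff)
  then show ?thesis by (simp add: sum.cartesian_product case_prod_unfold)
qed

lemma reward_Suc:
  assumes \<sigma>: "is_strategy \<sigma>"
  shows "reward \<sigma> (Suc t) k = (\<Sum>a\<in>set_pmf (\<sigma> []). pmf (\<sigma> []) a *
     (\<Sum>s\<in>signals a. \<Sum>k'\<in>UNIV. pmf (q k a) (s, k') * reward (continuation \<sigma> a s) t k'))"
proof -
  let ?f = "\<lambda>(k, h). measure_pmf.expectation (\<sigma> h) (g k)"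
  let ?B = "\<lambda>a. bind_pmf (q k a) (\<lambda>(s, k'). map_pmf (\<lambda>(k'', h). (k'', (a, s) # h))
      (state_hist q (return_pmf k') (continuation \<sigma> a s) t))"
  have fin: "finite (set_pmf (?B a))" for a
    using finite_set_state_hist[OF is_strategy_continuation[OF \<sigma>]]
    by (auto simp: finite_q)
  have "reward \<sigma> (Suc t) k = measure_pmf.expectation (bind_pmf (\<sigma> []) ?B) ?f"
    unfolding reward_def stage_payoff_def state_hist_Suc_first_step by simp
  also have "\<dots> = (\<Sum>a\<in>set_pmf (\<sigma> []). pmf (\<sigma> []) a * measure_pmf.expectation (?B a) ?f)"
    using finite_strategy[OF \<sigma>] by (subst pmf_expectation_bind) (auto simp: fin simp del: set_bind_pmf)
  also have "\<dots> = (\<Sum>a\<in>set_pmf (\<sigma> []). pmf (\<sigma> []) a *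
      (\<Sum>z\<in>set_pmf (q k a). pmf (q k a) z * reward (continuation \<sigma> a (fst z)) t (snd z)))"
  proof (intro sum.cong refl arg_cong2[of _ _ _ _ "(*)"])
    fix a
    show "measure_pmf.expectation (?B a) ?f =
      (\<Sum>z\<in>set_pmf (q k a). pmf (q k a) z * reward (continuation \<sigma> a (fst z)) t (snd z))"
      using finite_set_state_hist[OF is_strategy_continuation[OF \<sigma>]]
      by (subst pmf_expectation_bind[OF finite_q])
        (auto simp: case_prod_unfold reward_def stage_payoff_def continuation_def)
  qed
  finally show ?thesis by (simp add: sum_transition)
qed

lemma reward_bounds:
  assumes "is_strategy \<sigma>"
  shows "0 \<le> reward \<sigma> t k" "reward \<sigma> t k \<le> 1"
proof -
  have b: "0 \<le> measure_pmf.expectation (\<sigma> h) (g k)" "measure_pmf.expectation (\<sigma> h) (g k) \<le> 1" for h k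
    by (auto simp: g_nonneg g_le_1 integrable_measure_pmf_finite finite_strategy[OF assms]
        intro!: measure_pmf.integral_le_const integral_nonneg)
  show "0 \<le> reward \<sigma> t k" "reward \<sigma> t k \<le> 1"
    unfolding reward_def stage_payoff_def
    by (auto simp: b integrable_measure_pmf_finite finite_set_state_hist[OF assms] case_prod_unfold
        intro!: measure_pmf.integral_le_const Bochner_Integration.integral_nonneg)
qed

text \<open>Linearity absorbs the transition probabilities into \<open>push\<close>, so no division
  by the probability of a signal occurs.\<close>

lemma reward_vec_Suc:
  assumes \<sigma>: "is_strategy \<sigma>"
  shows "reward_vec \<sigma> (Suc t) x = (\<Sum>a\<in>set_pmf (\<sigma> []). pmf (\<sigma> []) a *
     (\<Sum>s\<in>signals a. reward_vec (continuation \<sigma> a s) t (push a s x)))"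
proof -
  have "reward_vec \<sigma> (Suc t) x = (\<Sum>k\<in>UNIV. \<Sum>a\<in>set_pmf (\<sigma> []). \<Sum>s\<in>signals a. \<Sum>k'\<in>UNIV.
      x $ k * (pmf (\<sigma> []) a * (pmf (q k a) (s, k') * reward (continuation \<sigma> a s) t k')))"
    by (simp add: reward_vec_def reward_Suc[OF \<sigma>] sum_distrib_left)
  also have "\<dots> = (\<Sum>a\<in>set_pmf (\<sigma> []). \<Sum>s\<in>signals a. \<Sum>k'\<in>UNIV. \<Sum>k\<in>UNIV.
      x $ k * (pmf (\<sigma> []) a * (pmf (q k a) (s, k') * reward (continuation \<sigma> a s) t k')))"
    by (subst sum.swap, rule sum.cong[OF refl], subst sum.swap, rule sum.cong[OF refl], rule sum.swap)
  finally show ?thesis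
    by (simp add: reward_vec_def push_def sum_distrib_left sum_distrib_right mult_ac)
qed

lemma push_orthant: "x \<in> orthant \<Longrightarrow> push a s x \<in> orthant"
  by (auto simp: orthant_def push_def intro!: sum_nonneg mult_nonneg_nonneg)

text \<open>Errors proportional to the mass therefore add up over the signals without growing,
  however many steps are made.\<close>

lemma mass_push: "(\<Sum>s\<in>signals a. mass (push a s x)) = mass x"
proof -
  have 1: "(\<Sum>s\<in>signals a. \<Sum>k'\<in>UNIV. pmf (q k a) (s, k')) = 1" for k
    using sum_transition[of k a "\<lambda>_. 1"] sum_pmf_eq_1[OF finite_q[of k a] order_refl] by simp
  have "(\<Sum>s\<in>signals a. mass (push a s x)) =
      (\<Sum>s\<in>signals a. \<Sum>k'\<in>UNIV. \<Sum>k\<in>UNIV. x $ k * pmf (q k a) (s, k'))"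
    by (simp add: mass_def push_def)
  also have "\<dots> = (\<Sum>k\<in>UNIV. \<Sum>s\<in>signals a. \<Sum>k'\<in>UNIV. x $ k * pmf (q k a) (s, k'))"
    by (subst sum.swap[of _ UNIV UNIV], subst sum.swap[of _ UNIV]) (rule refl)
  also have "\<dots> = (\<Sum>k\<in>UNIV. x $ k * (\<Sum>s\<in>signals a. \<Sum>k'\<in>UNIV. pmf (q k a) (s, k')))"
    by (simp add: sum_distrib_left)
  finally show ?thesis by (simp add: 1 mass_def)
qed

lemma mass_nonneg: "x \<in> orthant \<Longrightarrow> 0 \<le> mass x"
  by (auto simp: mass_def orthant_def intro!: sum_nonneg)

lemma reward_vec_abs_le:
  assumes "is_strategy \<sigma>" shows "\<bar>reward_vec \<sigma> t x\<bar> \<le> (\<Sum>k\<in>UNIV. \<bar>x $ k\<bar>)"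
  unfolding reward_vec_def using reward_bounds[OF assms]
  by (intro order_trans[OF sum_abs] sum_mono) (auto simp: abs_mult mult_left_le)

lemma reward_vec_bounds:
  assumes "is_strategy \<sigma>" "x \<in> orthant"
  shows "0 \<le> reward_vec \<sigma> t x" "reward_vec \<sigma> t x \<le> mass x" "\<bar>reward_vec \<sigma> t x\<bar> \<le> mass x"
proof -
  show "0 \<le> reward_vec \<sigma> t x" "reward_vec \<sigma> t x \<le> mass x"
    using assms reward_bounds[OF assms(1)] unfolding reward_vec_def mass_def orthant_def
    by (auto intro!: sum_nonneg sum_mono mult_left_le)
  then show "\<bar>reward_vec \<sigma> t x\<bar> \<le> mass x" by simp
qed

lemma reward_vec_diff: "reward_vec \<sigma> t (x - y) = reward_vec \<sigma> t x - reward_vec \<sigma> t y"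
  by (simp add: reward_vec_def algebra_simps sum_subtractf)

lemma reward_vec_scale: "reward_vec \<sigma> t (c *\<^sub>R x) = c * reward_vec \<sigma> t x"
  by (simp add: reward_vec_def sum_distrib_left mult_ac)

lemma summable_reward_vec:
  assumes "is_evaluation \<theta>" "is_strategy \<sigma>"
  shows "summable (\<lambda>t. \<theta> t * reward_vec \<sigma> (t + j) x)"
  by (rule evaluation_summable_mult[OF assms(1) reward_vec_abs_le[OF assms(2)]])

lemma delayed_payoff_bounds:
  assumes "is_evaluation \<theta>" "is_strategy \<sigma>" "x \<in> orthant"
  shows "0 \<le> delayed_payoff j \<theta> \<sigma> x" "delayed_payoff j \<theta> \<sigma> x \<le> mass x"
  unfolding delayed_payoff_def
  using summable_reward_vec[OF assms(1,2)] evaluation_nonneg[OF assms(1)] reward_vec_bounds[OF assms(2,3)]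
  by (auto intro!: suminf_nonneg evaluation_suminf_mult_le[OF assms(1)])

lemma delayed_payoff_diff:
  assumes "is_evaluation \<theta>" "is_strategy \<sigma>"
  shows "delayed_payoff j \<theta> \<sigma> (x - y) = delayed_payoff j \<theta> \<sigma> x - delayed_payoff j \<theta> \<sigma> y"
  unfolding delayed_payoff_def
  by (simp add: suminf_diff summable_reward_vec[OF assms] reward_vec_diff right_diff_distrib)

lemma delayed_payoff_scale:
  assumes "is_evaluation \<theta>" "is_strategy \<sigma>"
  shows "delayed_payoff j \<theta> \<sigma> (c *\<^sub>R x) = c * delayed_payoff j \<theta> \<sigma> x"
  unfolding delayed_payoff_def
  by (simp add: suminf_mult[symmetric] summable_reward_vec[OF assms] reward_vec_scale mult_ac)

lemma delayed_payoff_le_l1: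
  assumes "is_evaluation \<theta>" "is_strategy \<sigma>"
  shows "delayed_payoff j \<theta> \<sigma> x \<le> (\<Sum>k\<in>UNIV. \<bar>x $ k\<bar>)"
  unfolding delayed_payoff_def
  by (rule evaluation_suminf_mult_le[OF assms(1) reward_vec_abs_le[OF assms(2)]])
    (use reward_vec_abs_le[OF assms(2)] abs_le_D1 in blast)

lemma delayed_payoff_Suc:
  assumes \<theta>: "is_evaluation \<theta>" and \<sigma>: "is_strategy \<sigma>"
  shows "delayed_payoff (Suc j) \<theta> \<sigma> x = (\<Sum>a\<in>set_pmf (\<sigma> []). pmf (\<sigma> []) a *
     (\<Sum>s\<in>signals a. delayed_payoff j \<theta> (continuation \<sigma> a s) (push a s x)))"
proof -
  let ?r = "\<lambda>a s t. reward_vec (continuation \<sigma> a s) (t + j) (push a s x)"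
  have sm: "summable (\<lambda>t. \<theta> t * ?r a s t)" for a s
    by (rule summable_reward_vec[OF \<theta> is_strategy_continuation[OF \<sigma>]])
  have "delayed_payoff (Suc j) \<theta> \<sigma> x =
      (\<Sum>t. \<Sum>a\<in>set_pmf (\<sigma> []). \<Sum>s\<in>signals a. pmf (\<sigma> []) a * (\<theta> t * ?r a s t))"
    unfolding delayed_payoff_def
    by (simp add: reward_vec_Suc[OF \<sigma>] sum_distrib_left mult_ac)
  also have "\<dots> = (\<Sum>a\<in>set_pmf (\<sigma> []). \<Sum>s\<in>signals a. pmf (\<sigma> []) a * (\<Sum>t. \<theta> t * ?r a s t))"
    by (simp add: suminf_sum summable_sum sm summable_mult suminf_mult)
  finally show ?thesis by (simp add: delayed_payoff_def sum_distrib_left)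
qed

section \<open>Elementary properties of the value\<close>

lemma strategy_exists: "\<exists>\<sigma>. is_strategy (\<sigma> :: ('a \<times> 's) list \<Rightarrow> 'a pmf)"
  by (rule exI[of _ "\<lambda>_. return_pmf undefined"]) (simp add: is_strategy_def)

lemma payoff_le_V:
  assumes "is_evaluation \<theta>" "is_strategy \<sigma>"
  shows "payoff \<theta> \<sigma> x \<le> V \<theta> x"
  unfolding V_def using assms
  by (intro cSUP_upper bdd_aboveI2[of _ _ "\<Sum>k\<in>UNIV. \<bar>x $ k\<bar>"] delayed_payoff_le_l1) auto

lemma V_least:
  assumes "\<And>\<sigma>. is_strategy \<sigma> \<Longrightarrow> payoff \<theta> \<sigma> x \<le> c"
  shows "V \<theta> x \<le> c"
  unfolding V_def using assms strategy_exists by (intro cSUP_least) auto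

lemma V_approx:
  assumes "is_evaluation \<theta>" "0 < e"
  shows "\<exists>\<sigma>. is_strategy \<sigma> \<and> V \<theta> x - e < payoff \<theta> \<sigma> x"
proof (rule ccontr)
  assume "\<not> ?thesis"
  then have "V \<theta> x \<le> V \<theta> x - e" by (intro V_least) (auto simp: not_less)
  then show False using assms(2) by simp
qed

text \<open>For a fixed strategy the payoff is linear and bounded by the l1 norm, and the supremum
  inherits the constant 1. As the constant does not depend on \<theta>, this is the equicontinuity
  behind the compactness arguments.\<close>

lemma V_lipschitz:
  assumes "is_evaluation \<theta>"
  shows "\<bar>V \<theta> x - V \<theta> y\<bar> \<le> (\<Sum>k\<in>UNIV. \<bar>x $ k - y $ k\<bar>)"
proof -
  have *: "V \<theta> x \<le> V \<theta> y + (\<Sum>k\<in>UNIV. \<bar>x $ k - y $ k\<bar>)" for x y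
  proof (rule V_least)
    fix \<sigma> :: "('a \<times> 's) list \<Rightarrow> 'a pmf" assume \<sigma>: "is_strategy \<sigma>"
    have "payoff \<theta> \<sigma> x = payoff \<theta> \<sigma> y + payoff \<theta> \<sigma> (x - y)"
      by (simp add: delayed_payoff_diff[OF assms \<sigma>])
    then show "payoff \<theta> \<sigma> x \<le> V \<theta> y + (\<Sum>k\<in>UNIV. \<bar>x $ k - y $ k\<bar>)"
      using payoff_le_V[OF assms \<sigma>, of y] delayed_payoff_le_l1[OF assms \<sigma>, of 0 "x - y"] by simp
  qed
  show ?thesis using *[of x y] *[of y x] by (simp add: abs_le_iff abs_minus_commute)
qed

lemma V_bounds:
  assumes "is_evaluation \<theta>" "x \<in> orthant"
  shows "0 \<le> V \<theta> x" "V \<theta> x \<le> mass x"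
proof -
  obtain \<sigma> where "is_strategy (\<sigma> :: ('a \<times> 's) list \<Rightarrow> 'a pmf)" using strategy_exists by blast
  then show "0 \<le> V \<theta> x"
    using delayed_payoff_bounds(1)[OF assms(1) _ assms(2)] payoff_le_V[OF assms(1)] order_trans by blast
  show "V \<theta> x \<le> mass x"
    by (rule V_least) (rule delayed_payoff_bounds(2)[OF assms(1) _ assms(2)])
qed

lemma V_scale:
  assumes \<theta>: "is_evaluation \<theta>" and "0 \<le> c"
  shows "V \<theta> (c *\<^sub>R x) = c * V \<theta> x"
proof (cases "c = 0")
  case True
  have "0 \<in> orthant" "mass 0 = 0" by (auto simp: orthant_def mass_def)
  then show ?thesis using V_bounds[OF \<theta>, of 0] True by simp
next
  case False
  then have c: "0 < c" using assms by simp
  have *: "V \<theta> (b *\<^sub>R y) \<le> b * V \<theta> y" if "0 < b" for b y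
    using that payoff_le_V[OF \<theta>] by (intro V_least) (simp add: delayed_payoff_scale[OF \<theta>])
  have "V \<theta> (inverse c *\<^sub>R (c *\<^sub>R x)) \<le> inverse c * V \<theta> (c *\<^sub>R x)" using c by (intro *) simp
  then have "c * V \<theta> x \<le> V \<theta> (c *\<^sub>R x)" using c by (simp add: field_simps)
  then show ?thesis using *[OF c, of x] by simp
qed

lemma V_zero: "is_evaluation \<theta> \<Longrightarrow> V \<theta> 0 = 0"
  using V_scale[of \<theta> 0 0] by simp

text \<open>Playing \<open>a\<close> and then an almost optimal strategy for each signal collects
  the left-hand side one stage late; the shift bound gives the price of that delay.\<close>

lemma V_almost_superharmonic:
  assumes \<theta>: "is_evaluation \<theta>" and x: "x \<in> orthant"
  shows "(\<Sum>s\<in>signals a. V \<theta> (push a s x)) \<le> V \<theta> x + 2 * mass x * TV \<theta>"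
proof (rule field_le_epsilon)
  fix e :: real assume e: "0 < e"
  define n where "n = real (card (signals a)) + 1"
  have n: "0 < n" by (simp add: n_def)
  have "\<exists>\<sigma>. is_strategy \<sigma> \<and> V \<theta> (push a s x) - e / n < payoff \<theta> \<sigma> (push a s x)" for s
    using V_approx[OF \<theta>] e n by simp
  then obtain \<tau> where \<tau>: "\<And>s. is_strategy (\<tau> s)"
    "\<And>s. V \<theta> (push a s x) - e / n < payoff \<theta> (\<tau> s) (push a s x)" by metis
  \<comment> \<open>Only the signal is read from the first entry, because the first action is always
    \<open>a\<close>.\<close>
  define \<sigma> where "\<sigma> h = (case h of [] \<Rightarrow> return_pmf a | z # h' \<Rightarrow> \<tau> (snd z) h')" for h :: "('a \<times> 's) list"
  have \<sigma>: "is_strategy \<sigma>" using \<tau>(1) by (auto simp: is_strategy_def \<sigma>_def split: list.split)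
  have cont: "continuation \<sigma> a s = \<tau> s" for s by (rule ext) (simp add: continuation_def \<sigma>_def)
  have "(\<Sum>s\<in>signals a. V \<theta> (push a s x)) \<le> (\<Sum>s\<in>signals a. payoff \<theta> (\<tau> s) (push a s x) + e / n)"
    using \<tau>(2) by (intro sum_mono) (smt (verit))
  also have "\<dots> = delayed_payoff 1 \<theta> \<sigma> x + card (signals a) * (e / n)"
    using delayed_payoff_Suc[OF \<theta> \<sigma>, of 0 x] by (simp add: sum.distrib cont \<sigma>_def)
  also have "card (signals a) * (e / n) \<le> e" using e n by (simp add: n_def field_simps)
  also have "delayed_payoff 1 \<theta> \<sigma> x \<le> payoff \<theta> \<sigma> x + 2 * mass x * TV \<theta>"
    using evaluation_delay_bound[OF \<theta>, of "\<lambda>t. reward_vec \<sigma> t x" "mass x" 1]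
      reward_vec_bounds(3)[OF \<sigma> x] by (simp add: delayed_payoff_def)
  also have "payoff \<theta> \<sigma> x \<le> V \<theta> x" by (rule payoff_le_V[OF \<theta> \<sigma>])
  finally show "(\<Sum>s\<in>signals a. V \<theta> (push a s x)) \<le> V \<theta> x + 2 * mass x * TV \<theta> + e" by simp
qed

text \<open>A supermartingale argument: no step raises the expectation of \<open>v\<close>, and mass
  is preserved, so the error does not accumulate with the delay.\<close>

lemma delayed_payoff_le_superharmonic:
  assumes \<theta>: "is_evaluation \<theta>"
    and V: "\<And>x. x \<in> orthant \<Longrightarrow> V \<theta> x \<le> v x + e * mass x"
    and super: "\<And>a x. x \<in> orthant \<Longrightarrow> (\<Sum>s\<in>signals a. v (push a s x)) \<le> v x"
    and "is_strategy \<sigma>" "x \<in> orthant"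
  shows "delayed_payoff j \<theta> \<sigma> x \<le> v x + e * mass x"
  using assms(4,5)
proof (induction j arbitrary: \<sigma> x)
  case 0
  then show ?case using payoff_le_V[OF \<theta>, of \<sigma> x] V[of x] by simp
next
  case (Suc j)
  have "delayed_payoff (Suc j) \<theta> \<sigma> x \<le> (\<Sum>a\<in>set_pmf (\<sigma> []). pmf (\<sigma> []) a * (v x + e * mass x))"
    unfolding delayed_payoff_Suc[OF \<theta> Suc.prems(1)]
  proof (intro sum_mono mult_left_mono)
    fix a
    have "(\<Sum>s\<in>signals a. delayed_payoff j \<theta> (continuation \<sigma> a s) (push a s x))
        \<le> (\<Sum>s\<in>signals a. v (push a s x) + e * mass (push a s x))"
      by (intro sum_mono Suc.IH is_strategy_continuation push_orthant Suc.prems)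
    also have "\<dots> = (\<Sum>s\<in>signals a. v (push a s x)) + e * mass x"
      by (simp add: sum.distrib sum_distrib_left[symmetric] mass_push)
    also have "\<dots> \<le> v x + e * mass x" using super[OF Suc.prems(2)] by simp
    finally show "(\<Sum>s\<in>signals a. delayed_payoff j \<theta> (continuation \<sigma> a s) (push a s x))
        \<le> v x + e * mass x" .
  qed simp
  also have "\<dots> = v x + e * mass x"
    using sum_pmf_eq_1[OF finite_strategy[OF Suc.prems(1)] order_refl]
    by (simp add: sum_distrib_right[symmetric])
  finally show ?case .
qed

subsection \<open>Convergence of the values\<close>

lemma compact_simplex: "compact {x \<in> orthant. mass x = 1}"
proof -
  have "closed {x \<in> orthant. mass x = 1}"
  proof -
    have "{x \<in> orthant. mass x = 1} = (\<Inter>k. {x. 0 \<le> x $ k}) \<inter> {x. mass x = 1}"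
      by (auto simp: orthant_def)
    moreover have "closed {x. mass x = 1}" unfolding mass_def
      by (intro closed_Collect_eq continuous_intros)
    moreover have "closed (\<Inter>k. {x::real^'k. 0 \<le> x $ k})"
      by (intro closed_INT ballI closed_Collect_le continuous_intros)
    ultimately show ?thesis by auto
  qed
  moreover have "bounded {x \<in> orthant. mass x = 1}"
  proof (rule boundedI)
    fix x assume x: "x \<in> {x \<in> orthant. mass x = 1}"
    have "norm x \<le> (\<Sum>k\<in>UNIV. \<bar>x $ k\<bar>)" by (rule norm_le_l1_cart)
    also have "\<dots> = mass x" using x by (simp add: orthant_def mass_def)
    finally show "norm x \<le> 1" using x by simp
  qed
  ultimately show ?thesis by (simp add: compact_eq_bounded_closed)
qed

text \<open>Arzela-Ascoli on the simplex, extended to the orthant by homogeneity. The numbers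
  \<open>c n\<close> enter as a second component constant in \<open>x\<close>, so that values and
  numbers converge along one subsequence.\<close>

lemma value_functions_subsequence:
  fixes c :: "nat \<Rightarrow> real"
  assumes \<theta>: "\<And>n. is_evaluation (\<theta> n)" and c: "\<And>n. \<bar>c n\<bar> \<le> B"
  shows "\<exists>k v l. strict_mono (k :: nat \<Rightarrow> nat) \<and> (\<forall>e>0. \<exists>N. \<forall>n\<ge>N. \<bar>c (k n) - l\<bar> \<le> e \<and>
       (\<forall>x\<in>orthant. \<bar>V (\<theta> (k n)) x - v x\<bar> \<le> e * mass x))"
proof -
  let ?S = "{x \<in> orthant. mass x = 1}"
  let ?F = "\<lambda>n x. (V (\<theta> n) x, c n)"
  obtain g k where k: "strict_mono (k :: nat \<Rightarrow> nat)"
    and lim: "\<And>e. 0 < e \<Longrightarrow> \<exists>N. \<forall>n x. n \<ge> N \<and> x \<in> ?S \<longrightarrow> norm (?F (k n) x - g x) < e"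
  proof (rule Arzela_Ascoli[OF compact_simplex, of ?F "1 + B"])
    show "norm (?F n x) \<le> 1 + B" if "x \<in> ?S" for n x
    proof -
      have "norm (?F n x) \<le> norm (V (\<theta> n) x) + norm (c n)" by (rule norm_Pair_le)
      then show ?thesis using V_bounds[OF \<theta>, of x n] c[of n] that by simp
    qed
    show "\<exists>d. 0 < d \<and> (\<forall>n y. y \<in> ?S \<and> norm (x - y) < d \<longrightarrow> norm (?F n x - ?F n y) < e)"
      if e: "0 < e" for x e
    proof (intro exI[of _ "e / CARD('k)"] conjI allI impI)
      show "0 < e / CARD('k)" using e by simp
      fix n y assume y: "y \<in> ?S \<and> norm (x - y) < e / CARD('k)"
      have "norm (?F n x - ?F n y) = \<bar>V (\<theta> n) x - V (\<theta> n) y\<bar>" by (simp add: norm_Pair)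
      also have "\<dots> \<le> (\<Sum>k\<in>UNIV. \<bar>x $ k - y $ k\<bar>)" by (rule V_lipschitz[OF \<theta>])
      also have "\<dots> \<le> (\<Sum>k\<in>(UNIV::'k set). norm (x - y))"
        using component_le_norm_cart[of "x - y"] by (intro sum_mono) simp
      also have "\<dots> < e" using y by (simp add: field_simps)
      finally show "norm (?F n x - ?F n y) < e" .
    qed
  qed blast
  \<comment> \<open>The homogeneous extension of the limit; at mass 0 the leading factor makes it
    vanish.\<close>
  define v where "v x = mass x * fst (g (inverse (mass x) *\<^sub>R x))" for x
  \<comment> \<open>Any point of the simplex serves to read off the limit of
    \<open>c\<close>.\<close>
  define x0 :: "real^'k" where "x0 = axis undefined 1"
  have x0: "x0 \<in> ?S" by (simp add: x0_def orthant_def mass_def axis_def)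
  have "\<exists>N. \<forall>n\<ge>N. \<bar>c (k n) - snd (g x0)\<bar> \<le> e \<and> (\<forall>x\<in>orthant. \<bar>V (\<theta> (k n)) x - v x\<bar> \<le> e * mass x)"
    if e: "0 < e" for e
  proof -
    obtain N where N: "\<And>n x. n \<ge> N \<Longrightarrow> x \<in> ?S \<Longrightarrow> norm (?F (k n) x - g x) < e"
      using lim[OF e] by blast
    have comp: "\<bar>V (\<theta> (k n)) x - fst (g x)\<bar> \<le> e" "\<bar>c (k n) - snd (g x)\<bar> \<le> e"
      if "n \<ge> N" "x \<in> ?S" for n x
      using N[OF that] norm_fst_le[of "V (\<theta> (k n)) x - fst (g x)" "c (k n) - snd (g x)"]
        norm_snd_le[of "c (k n) - snd (g x)" "V (\<theta> (k n)) x - fst (g x)"]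
      by (simp_all add: minus_prod_def)
    have "\<bar>V (\<theta> (k n)) x - v x\<bar> \<le> e * mass x" if n: "n \<ge> N" and x: "x \<in> orthant" for n x
    proof (cases "mass x = 0")
      case True
      then show ?thesis using V_bounds[OF \<theta> x, of "k n"] by (simp add: v_def)
    next
      case False
      then have t: "0 < mass x" using mass_nonneg[OF x] by simp
      let ?y = "inverse (mass x) *\<^sub>R x"
      have y: "?y \<in> ?S" using t x
        by (auto simp: orthant_def mass_def sum_distrib_left[symmetric])
      have "V (\<theta> (k n)) x = V (\<theta> (k n)) (mass x *\<^sub>R ?y)" using t by simp
      also have "\<dots> = mass x * V (\<theta> (k n)) ?y" using t by (intro V_scale[OF \<theta>]) simp
      finally have "\<bar>V (\<theta> (k n)) x - v x\<bar> = mass x * \<bar>V (\<theta> (k n)) ?y - fst (g ?y)\<bar>"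
        using t by (simp add: v_def right_diff_distrib[symmetric] abs_mult)
      also have "\<dots> \<le> mass x * e" using comp(1)[OF n y] t by (intro mult_left_mono) auto
      finally show ?thesis by (simp add: mult.commute)
    qed
    then show ?thesis using comp(2)[OF _ x0] by blast
  qed
  with k show ?thesis by blast
qed

corollary value_functions_uniform_limit:
  assumes "\<And>n. is_evaluation (\<theta> n)"
  shows "\<exists>k v. strict_mono (k :: nat \<Rightarrow> nat) \<and>
    (\<forall>e>0. \<exists>N. \<forall>n\<ge>N. \<forall>x\<in>orthant. \<bar>V (\<theta> (k n)) x - v x\<bar> \<le> e * mass x)"
proof -
  obtain k v l where "strict_mono (k :: nat \<Rightarrow> nat)" and "\<forall>e>0. \<exists>N. \<forall>n\<ge>N. \<bar>(0::real) - l\<bar> \<le> e \<and>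
       (\<forall>x\<in>orthant. \<bar>V (\<theta> (k n)) x - v x\<bar> \<le> e * mass x)"
    using value_functions_subsequence[of \<theta> "\<lambda>_. 0" 0, OF assms] by auto
  then show ?thesis by (intro exI[of _ k] exI[of _ v]) meson
qed

text \<open>The defect in \<open>V_almost_superharmonic\<close> vanishes with the variation, and the
  error of the uniform approximation is controlled because \<open>push\<close> preserves
  mass.\<close>

lemma limit_superharmonic:
  assumes \<theta>: "\<And>n. is_evaluation (\<theta> n)" and TV: "(\<lambda>n. TV (\<theta> n)) \<longlonglongrightarrow> 0"
    and lim: "\<And>e. 0 < e \<Longrightarrow> \<exists>N. \<forall>n\<ge>N. \<forall>x\<in>orthant. \<bar>V (\<theta> n) x - v x\<bar> \<le> e * mass x"
    and x: "x \<in> orthant"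
  shows "(\<Sum>s\<in>signals a. v (push a s x)) \<le> v x"
proof (rule field_le_epsilon)
  fix d :: real assume d: "0 < d"
  \<comment> \<open>Four errors of size \<open>e * mass x\<close> occur: two for exchanging
    \<open>v\<close> and \<open>V\<close>, two from the variation term. The added 1 keeps the
    denominator positive.\<close>
  define e where "e = d / (4 * mass x + 1)"
  have t: "0 \<le> mass x" using x by (rule mass_nonneg)
  have e: "0 < e" using d t by (simp add: e_def)
  obtain N where N: "\<And>n x. n \<ge> N \<Longrightarrow> x \<in> orthant \<Longrightarrow> \<bar>V (\<theta> n) x - v x\<bar> \<le> e * mass x"
    using lim[OF e] by blast
  obtain M where M: "\<And>n. n \<ge> M \<Longrightarrow> TV (\<theta> n) < e"
    using order_tendstoD(2)[OF TV e] by (auto simp: eventually_sequentially)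
  define n where "n = max N M"
  have "(\<Sum>s\<in>signals a. v (push a s x)) \<le> (\<Sum>s\<in>signals a. V (\<theta> n) (push a s x) + e * mass (push a s x))"
  proof (rule sum_mono)
    fix s
    show "v (push a s x) \<le> V (\<theta> n) (push a s x) + e * mass (push a s x)"
      using N[of n "push a s x"] push_orthant[OF x] by (simp add: n_def)
  qed
  also have "\<dots> = (\<Sum>s\<in>signals a. V (\<theta> n) (push a s x)) + e * mass x"
    by (simp add: sum.distrib sum_distrib_left[symmetric] mass_push)
  also have "\<dots> \<le> V (\<theta> n) x + 2 * mass x * TV (\<theta> n) + e * mass x"
    using V_almost_superharmonic[OF \<theta> x] by simp
  also have "\<dots> \<le> (v x + e * mass x) + 2 * mass x * e + e * mass x"
    using N[of n x] x M[of n] t e by (intro add_mono mult_left_mono) (auto simp: n_def)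
  also have "\<dots> \<le> v x + d"
  proof -
    have "e * (4 * mass x + 1) = d" using t by (simp add: e_def)
    then show ?thesis using e by (simp add: algebra_simps)
  qed
  finally show "(\<Sum>s\<in>signals a. v (push a s x)) \<le> v x + d" .
qed

text \<open>A slowly varying evaluation \<open>\<eta>\<close> is close to its convolution with \<open>\<theta>\<close>, and the payoff
  of the convolution is an average of \<open>\<theta>\<close>-payoffs delayed by random times.\<close>
lemma V_le_superharmonic:
  assumes \<theta>: "is_evaluation \<theta>" and e: "0 < e"
    and V: "\<And>x. x \<in> orthant \<Longrightarrow> V \<theta> x \<le> v x + e * mass x"
    and super: "\<And>a x. x \<in> orthant \<Longrightarrow> (\<Sum>s\<in>signals a. v (push a s x)) \<le> v x"
  shows "\<exists>\<alpha>>0. \<forall>\<eta>. is_evaluation \<eta> \<longrightarrow> TV \<eta> \<le> \<alpha> \<longrightarrow> (\<forall>x\<in>orthant. V \<eta> x \<le> v x + 3 * e * mass x)"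
proof -
  have "(\<lambda>n. \<Sum>t<n. \<theta> t) \<longlonglongrightarrow> 1" using \<theta> by (simp add: is_evaluation_def sums_def)
  then have "\<forall>\<^sub>F n in sequentially. 1 - e < (\<Sum>t<n. \<theta> t)" using e by (intro order_tendstoD(1)) auto
  \<comment> \<open>Up to weight \<open>e\<close>, the evaluation \<theta> lives on the first
    \<open>T\<close> stages, so only delays below \<open>T\<close> matter.\<close>
  then obtain T where T: "1 - e < (\<Sum>t<T. \<theta> t)" by (auto simp: eventually_sequentially)
  define S where "S = (\<Sum>t<T. \<theta> t)"
  have S: "1 - e < S" "S \<le> 1" "0 \<le> S"
    using T sum_le_suminf[OF evaluation_summable[OF \<theta>], of "{..<T}"] evaluation_suminf[OF \<theta>]
      evaluation_nonneg[OF \<theta>] by (auto simp: S_def intro: sum_nonneg)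
  \<comment> \<open>Small enough that a delay of at most \<open>T\<close> stages changes an
    \<eta>-payoff by at most \<open>e * mass x\<close>.\<close>
  define \<alpha> where "\<alpha> = e / (2 * real T + 1)"
  have \<alpha>: "0 < \<alpha>" "2 * real T * \<alpha> \<le> e" using e by (auto simp: \<alpha>_def field_simps)
  have "V \<eta> x \<le> v x + 3 * e * mass x"
    if \<eta>: "is_evaluation \<eta>" and TV: "TV \<eta> \<le> \<alpha>" and x: "x \<in> orthant" for \<eta> x
  proof (rule V_least)
    fix \<sigma> :: "('a \<times> 's) list \<Rightarrow> 'a pmf" assume \<sigma>: "is_strategy \<sigma>"
    note rb = reward_vec_bounds[OF \<sigma> x]
    have t: "0 \<le> mass x" using x by (rule mass_nonneg)
    \<comment> \<open>The truncated \<theta>-payoff from stage \<open>j\<close> on. Its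
      \<eta>-average is the same double sum as the truncated \<theta>-average of the delayed
      \<eta>-payoffs: the first form is bounded through \<open>v\<close>, the second is compared
      with the undelayed payoff \<open>A\<close>.\<close>
    define \<rho> where "\<rho> j = (\<Sum>t<T. \<theta> t * reward_vec \<sigma> (j + t) x)" for j
    have \<rho>: "\<bar>\<rho> j\<bar> \<le> mass x" for j
    proof -
      have "\<bar>\<rho> j\<bar> \<le> (\<Sum>t<T. \<theta> t * mass x)" unfolding \<rho>_def
        using rb evaluation_nonneg[OF \<theta>]
        by (intro order_trans[OF sum_abs] sum_mono) (auto simp: abs_mult intro: mult_left_mono)
      also have "\<dots> = S * mass x" by (simp add: S_def sum_distrib_right)
      also have "\<dots> \<le> mass x" using S t by (simp add: mult_left_le_one_le)
      finally show ?thesis .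
    qed
    have "(\<Sum>t<T. \<theta> t * delayed_payoff t \<eta> \<sigma> x) = (\<Sum>j. \<eta> j * \<rho> j)"
    proof -
      have "(\<Sum>t<T. \<theta> t * delayed_payoff t \<eta> \<sigma> x) = (\<Sum>t<T. \<Sum>j. \<theta> t * (\<eta> j * reward_vec \<sigma> (j + t) x))"
        unfolding delayed_payoff_def by (simp add: suminf_mult summable_reward_vec[OF \<eta> \<sigma>])
      also have "\<dots> = (\<Sum>j. \<Sum>t<T. \<theta> t * (\<eta> j * reward_vec \<sigma> (j + t) x))"
        by (intro suminf_sum[symmetric] summable_mult summable_reward_vec[OF \<eta> \<sigma>])
      finally show ?thesis by (simp add: \<rho>_def sum_distrib_left mult_ac)
    qed
    also have "\<dots> \<le> v x + e * mass x"
    proof (rule evaluation_suminf_mult_le[OF \<eta> \<rho>])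
      fix j
      have "\<rho> j \<le> delayed_payoff j \<theta> \<sigma> x"
        unfolding \<rho>_def delayed_payoff_def
        using sum_le_suminf[OF summable_reward_vec[OF \<theta> \<sigma>, of j x], of "{..<T}"]
          rb(1) evaluation_nonneg[OF \<theta>] by (simp add: add.commute)
      also have "\<dots> \<le> v x + e * mass x"
        by (rule delayed_payoff_le_superharmonic[OF \<theta> V super \<sigma> x])
      finally show "\<rho> j \<le> v x + e * mass x" .
    qed
    finally have up: "(\<Sum>t<T. \<theta> t * delayed_payoff t \<eta> \<sigma> x) \<le> v x + e * mass x" .
    define A where "A = payoff \<eta> \<sigma> x"
    have "A - e * mass x \<le> delayed_payoff t \<eta> \<sigma> x" if "t < T" for t
    proof -
      have "\<bar>delayed_payoff t \<eta> \<sigma> x - A\<bar> \<le> 2 * real t * mass x * TV \<eta>"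
        unfolding A_def delayed_payoff_def
        using evaluation_delay_bound[OF \<eta>, of "\<lambda>t. reward_vec \<sigma> t x", OF rb(3)] by simp
      also have "\<dots> \<le> 2 * real T * mass x * \<alpha>"
        using that TV t TV_nonneg[OF \<eta>] by (intro mult_mono) auto
      also have "\<dots> \<le> e * mass x" using mult_right_mono[OF \<alpha>(2) t] by (simp add: mult_ac)
      finally show ?thesis by simp
    qed
    then have "(\<Sum>t<T. \<theta> t * (A - e * mass x)) \<le> (\<Sum>t<T. \<theta> t * delayed_payoff t \<eta> \<sigma> x)"
      using evaluation_nonneg[OF \<theta>] by (intro sum_mono mult_left_mono) auto
    then have lo: "S * (A - e * mass x) \<le> v x + e * mass x"
      using up by (simp add: S_def sum_distrib_right)
    have "A \<le> mass x" unfolding A_def by (rule delayed_payoff_bounds(2)[OF \<eta> \<sigma> x])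
    then have "A - e * mass x \<le> mass x" using e t by (smt (verit) mult_nonneg_nonneg)
    then have "(1 - S) * (A - e * mass x) \<le> (1 - S) * mass x" using S by (intro mult_left_mono) auto
    also have "\<dots> \<le> e * mass x" using S t by (intro mult_right_mono) auto
    finally have "A - e * mass x \<le> v x + 2 * (e * mass x)" using lo by (simp add: algebra_simps)
    then show "payoff \<eta> \<sigma> x \<le> v x + 3 * e * mass x" by (simp add: A_def)
  qed
  with \<alpha>(1) show ?thesis by blast
qed

text \<open>The candidate \<open>v\<close> is a subsequential limit of the values of the Cesaro
  averages. It is superharmonic, so \<open>V_le_superharmonic\<close> bounds all values of slowly
  varying evaluations from above; the lower bound compares \<open>v\<close> with any other possible
  limit.\<close>

theorem value_convergence:
  "\<exists>v. \<forall>e>0. \<exists>\<alpha>>0. \<forall>\<theta>. is_evaluation \<theta> \<longrightarrow> TV \<theta> \<le> \<alpha> \<longrightarrow> (\<forall>x\<in>orthant. \<bar>V \<theta> x - v x\<bar> \<le> e * mass x)"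
proof -
  have "(\<lambda>n. 1 / real (Suc n)) \<longlonglongrightarrow> 0" by (rule LIMSEQ_Suc[OF lim_1_over_n])
  then have inv0: "(\<lambda>n. 1 / real (Suc (k n))) \<longlonglongrightarrow> 0" if "strict_mono k" for k
    using LIMSEQ_subseq_LIMSEQ[OF _ that, of "\<lambda>n. 1 / real (Suc n)" 0] by (simp add: o_def)
  obtain k v where k: "strict_mono (k :: nat \<Rightarrow> nat)"
    and lim': "\<forall>e>0. \<exists>N. \<forall>n\<ge>N. \<forall>x\<in>orthant. \<bar>V (uniform_evaluation (k n)) x - v x\<bar> \<le> e * mass x"
    using value_functions_uniform_limit[of uniform_evaluation, OF is_evaluation_uniform] by blast
  have lim: "\<exists>N. \<forall>n\<ge>N. \<forall>x\<in>orthant. \<bar>V (uniform_evaluation (k n)) x - v x\<bar> \<le> e * mass x" if "0 < e" for e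
    using lim' that by blast
  let ?u = "\<lambda>n. uniform_evaluation (k n)"
  have TVu: "(\<lambda>n. TV (?u n)) \<longlonglongrightarrow> 0" using inv0[OF k] by (simp add: TV_uniform)
  have super: "(\<Sum>s\<in>signals a. v (push a s x)) \<le> v x" if "x \<in> orthant" for a x
    by (rule limit_superharmonic[OF is_evaluation_uniform TVu lim that])
  have upper: "\<exists>\<alpha>>0. \<forall>\<eta>. is_evaluation \<eta> \<longrightarrow> TV \<eta> \<le> \<alpha> \<longrightarrow> (\<forall>x\<in>orthant. V \<eta> x \<le> v x + 3 * e * mass x)"
    if e: "0 < e" for e
  proof -
    obtain N where N: "\<And>x. x \<in> orthant \<Longrightarrow> \<bar>V (?u N) x - v x\<bar> \<le> e * mass x"
      using lim[OF e] by blast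
    have "V (?u N) x \<le> v x + e * mass x" if "x \<in> orthant" for x using N[OF that] by simp
    then show ?thesis by (intro V_le_superharmonic[OF is_evaluation_uniform e _ super])
  qed
  \<comment> \<open>A failure would give evaluations of vanishing variation whose values stay below
    \<open>v\<close> somewhere. Their values have a subsequential limit \<open>w\<close>, and
    \<open>v x \<le> w x\<close> yields the contradiction.\<close>
  have lower: "\<exists>\<alpha>>0. \<forall>\<eta>. is_evaluation \<eta> \<longrightarrow> TV \<eta> \<le> \<alpha> \<longrightarrow> (\<forall>x\<in>orthant. v x - e * mass x \<le> V \<eta> x)"
    if e: "0 < e" for e
  proof (rule ccontr)
    assume neg: "\<not> ?thesis"
    have "\<exists>\<eta>. is_evaluation \<eta> \<and> TV \<eta> \<le> 1 / real (Suc n) \<and> (\<exists>x\<in>orthant. V \<eta> x < v x - e * mass x)" for n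
    proof (rule ccontr)
      assume "\<not> ?thesis"
      then have "\<forall>\<eta>. is_evaluation \<eta> \<longrightarrow> TV \<eta> \<le> 1 / real (Suc n) \<longrightarrow>
          (\<forall>x\<in>orthant. v x - e * mass x \<le> V \<eta> x)" by (auto simp: not_less)
      moreover have "0 < 1 / real (Suc n)" by simp
      ultimately show False using neg by blast
    qed
    then obtain \<eta> where \<eta>: "\<And>n. is_evaluation (\<eta> n)" "\<And>n. TV (\<eta> n) \<le> 1 / real (Suc n)"
      "\<And>n. \<exists>x\<in>orthant. V (\<eta> n) x < v x - e * mass x" by metis
    obtain j w where j: "strict_mono (j :: nat \<Rightarrow> nat)"
      and limw': "\<forall>e>0. \<exists>N. \<forall>n\<ge>N. \<forall>x\<in>orthant. \<bar>V (\<eta> (j n)) x - w x\<bar> \<le> e * mass x"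
      using value_functions_uniform_limit[of \<eta>, OF \<eta>(1)] by blast
    have limw: "\<exists>N. \<forall>n\<ge>N. \<forall>x\<in>orthant. \<bar>V (\<eta> (j n)) x - w x\<bar> \<le> e * mass x" if "0 < e" for e
      using limw' that by blast
    have TV\<eta>: "(\<lambda>n. TV (\<eta> (j n))) \<longlonglongrightarrow> 0"
      by (rule tendsto_sandwich[OF _ _ tendsto_const inv0[OF j]])
        (intro always_eventually allI TV_nonneg \<eta>)+
    have superw: "(\<Sum>s\<in>signals a. w (push a s x)) \<le> w x" if "x \<in> orthant" for a x
      by (rule limit_superharmonic[of "\<lambda>n. \<eta> (j n)", OF \<eta>(1) TV\<eta> limw that])
    \<comment> \<open>The roles are exchanged: \<open>w\<close> is superharmonic too, so it bounds
      the Cesaro values from above, and these approach \<open>v\<close>.\<close>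
    have vw: "v x \<le> w x" if x: "x \<in> orthant" for x
    proof (rule field_le_epsilon)
      fix d :: real assume d: "0 < d"
      have t: "0 \<le> mass x" using x by (rule mass_nonneg)
      define e' where "e' = d / (4 * mass x + 1)"
      have e': "0 < e'" using d t by (simp add: e'_def)
      obtain N where N: "\<And>x. x \<in> orthant \<Longrightarrow> \<bar>V (\<eta> (j N)) x - w x\<bar> \<le> e' * mass x"
        using limw[OF e'] by blast
      have "V (\<eta> (j N)) x \<le> w x + e' * mass x" if "x \<in> orthant" for x using N[OF that] by simp
      then obtain \<alpha> where \<alpha>: "0 < \<alpha>" "\<And>\<theta> x. is_evaluation \<theta> \<Longrightarrow> TV \<theta> \<le> \<alpha> \<Longrightarrow> x \<in> orthant \<Longrightarrow>
          V \<theta> x \<le> w x + 3 * e' * mass x"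
        using V_le_superharmonic[OF \<eta>(1) e' _ superw, of "j N"] by blast
      obtain M where M: "\<And>n. n \<ge> M \<Longrightarrow> TV (?u n) < \<alpha>"
        using order_tendstoD(2)[OF TVu \<alpha>(1)] by (auto simp: eventually_sequentially)
      obtain N' where N': "\<And>n x. n \<ge> N' \<Longrightarrow> x \<in> orthant \<Longrightarrow> \<bar>V (?u n) x - v x\<bar> \<le> e' * mass x"
        using lim[OF e'] by blast
      let ?n = "max M N'"
      have "v x \<le> V (?u ?n) x + e' * mass x" using N'[of ?n x] x by simp
      also have "V (?u ?n) x \<le> w x + 3 * e' * mass x"
        using M[of ?n] x by (intro \<alpha>(2) is_evaluation_uniform) auto
      finally have "v x \<le> w x + 4 * (e' * mass x)" by simp
      moreover have "e' * (4 * mass x + 1) = d" using t by (simp add: e'_def)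
      ultimately show "v x \<le> w x + d" using e' by (simp add: algebra_simps)
    qed
    obtain N where N: "\<And>x. x \<in> orthant \<Longrightarrow> \<bar>V (\<eta> (j N)) x - w x\<bar> \<le> e * mass x"
      using limw[OF e] by blast
    obtain x where x: "x \<in> orthant" "V (\<eta> (j N)) x < v x - e * mass x" using \<eta>(3) by blast
    show False using N[OF x(1)] vw[OF x(1)] x(2) by linarith
  qed
  show ?thesis
  proof (intro exI[of _ v] allI impI)
    fix e :: real assume e: "0 < e"
    obtain \<alpha> where \<alpha>: "0 < \<alpha>" "\<And>\<eta> x. is_evaluation \<eta> \<Longrightarrow> TV \<eta> \<le> \<alpha> \<Longrightarrow> x \<in> orthant \<Longrightarrow>
        V \<eta> x \<le> v x + 3 * (e / 3) * mass x"
      using upper[of "e / 3"] e by auto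
    obtain \<beta> where \<beta>: "0 < \<beta>" "\<And>\<eta> x. is_evaluation \<eta> \<Longrightarrow> TV \<eta> \<le> \<beta> \<Longrightarrow> x \<in> orthant \<Longrightarrow>
        v x - e * mass x \<le> V \<eta> x"
      using lower[OF e] by auto
    show "\<exists>\<alpha>>0. \<forall>\<theta>. is_evaluation \<theta> \<longrightarrow> TV \<theta> \<le> \<alpha> \<longrightarrow> (\<forall>x\<in>orthant. \<bar>V \<theta> x - v x\<bar> \<le> e * mass x)"
    proof (intro exI[of _ "min \<alpha> \<beta>"] conjI allI impI ballI)
      fix \<theta> x assume "is_evaluation \<theta>" "TV \<theta> \<le> min \<alpha> \<beta>" "x \<in> orthant"
      then show "\<bar>V \<theta> x - v x\<bar> \<le> e * mass x" using \<alpha>(2)[of \<theta> x] \<beta>(2)[of \<theta> x] by simp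
    qed (use \<alpha> \<beta> in simp)
  qed
qed

subsection \<open>Realising payoff streams\<close>

text \<open>Total boundedness, extracted from sequential compactness. One net serves both the value
  functions and the pairing with \<open>r\<close>, since the constraint of a stream against an
  evaluation involves the two together.\<close>

lemma value_functions_net:
  assumes e: "0 < e" and r: "\<And>t. \<bar>r t\<bar> \<le> 1"
  shows "\<exists>F. finite F \<and> (\<forall>\<theta>\<in>F. is_evaluation \<theta>) \<and> (\<forall>\<theta>. is_evaluation \<theta> \<longrightarrow> (\<exists>\<theta>'\<in>F.
    \<bar>(\<Sum>t. \<theta> t * r t) - (\<Sum>t. \<theta>' t * r t)\<bar> \<le> e \<and> (\<forall>x\<in>orthant. \<bar>V \<theta> x - V \<theta>' x\<bar> \<le> e * mass x)))"
proof (rule ccontr)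
  define near where "near \<theta> \<theta>' \<longleftrightarrow> \<bar>(\<Sum>t. \<theta> t * r t) - (\<Sum>t. \<theta>' t * r t)\<bar> \<le> e \<and>
      (\<forall>x\<in>orthant. \<bar>V \<theta> x - V \<theta>' x\<bar> \<le> e * mass x)" for \<theta> \<theta>'
  assume "\<not> ?thesis"
  then have none: "\<not> (\<exists>F. finite F \<and> (\<forall>\<theta>\<in>F. is_evaluation \<theta>) \<and>
      (\<forall>\<theta>. is_evaluation \<theta> \<longrightarrow> (\<exists>\<theta>'\<in>F. near \<theta> \<theta>')))" by (simp only: near_def simp_thms)
  have neg: "\<exists>\<theta>. is_evaluation \<theta> \<and> (\<forall>\<theta>'\<in>F. \<not> near \<theta> \<theta>')"
    if "finite F" "\<forall>\<theta>\<in>F. is_evaluation \<theta>" for F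
  proof (rule ccontr)
    assume "\<not> ?thesis"
    then have "\<forall>\<theta>. is_evaluation \<theta> \<longrightarrow> (\<exists>\<theta>'\<in>F. near \<theta> \<theta>')" by simp
    with that have "finite F \<and> (\<forall>\<theta>\<in>F. is_evaluation \<theta>) \<and>
      (\<forall>\<theta>. is_evaluation \<theta> \<longrightarrow> (\<exists>\<theta>'\<in>F. near \<theta> \<theta>'))" by simp
    then show False by (rule notE[OF none exI])
  qed
  \<comment> \<open>Without a finite net, pairwise separated evaluations can be chosen one after
    another; a convergent subsequence then contradicts their separation.\<close>
  have "\<exists>f :: nat \<Rightarrow> nat \<Rightarrow> real. \<forall>n. is_evaluation (f n) \<and> (\<forall>m<n. \<not> near (f n) (f m))"
  proof (rule dependent_wellorder_choice[where P = "\<lambda>f n \<theta>. is_evaluation \<theta> \<and> (\<forall>m<n. \<not> near \<theta> (f m))"])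
    fix n :: nat and f :: "nat \<Rightarrow> nat \<Rightarrow> real"
    assume "\<And>m. m < n \<Longrightarrow> is_evaluation (f m) \<and> (\<forall>i<m. \<not> near (f m) (f i))"
    then show "\<exists>\<theta>. is_evaluation \<theta> \<and> (\<forall>m<n. \<not> near \<theta> (f m))"
      using neg[of "f ` {..<n}"] by auto
  qed auto
  then obtain f :: "nat \<Rightarrow> nat \<Rightarrow> real" where f: "\<And>n. is_evaluation (f n)" "\<And>m n. m < n \<Longrightarrow> \<not> near (f n) (f m)" by blast
  have "\<bar>\<Sum>t. f n t * r t\<bar> \<le> 1" for n
  proof -
    have "(\<Sum>t. f n t * r t) \<le> 1"
      by (rule evaluation_suminf_mult_le[OF f(1), of r 1]) (simp_all add: r abs_le_D1[OF r])
    moreover have "(\<Sum>t. f n t * - r t) \<le> 1"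
      by (rule evaluation_suminf_mult_le[OF f(1), of "\<lambda>t. - r t" 1]) (simp add: r, rule abs_le_D2[OF r])
    moreover have "summable (\<lambda>t. f n t * r t)"
      by (rule evaluation_summable_mult[OF f(1), of r 1]) (rule r)
    ultimately show ?thesis
      using suminf_minus[of "\<lambda>t. f n t * r t"] by (simp add: abs_le_iff)
  qed
  then obtain k v l where k: "strict_mono (k :: nat \<Rightarrow> nat)"
    and lim: "\<forall>e>0. \<exists>N. \<forall>n\<ge>N. \<bar>(\<Sum>t. f (k n) t * r t) - l\<bar> \<le> e \<and>
       (\<forall>x\<in>orthant. \<bar>V (f (k n)) x - v x\<bar> \<le> e * mass x)"
    using value_functions_subsequence[of f "\<lambda>n. \<Sum>t. f n t * r t" 1, OF f(1)] by blast
  obtain N where N: "\<And>n. n \<ge> N \<Longrightarrow> \<bar>(\<Sum>t. f (k n) t * r t) - l\<bar> \<le> e / 2 \<and>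
       (\<forall>x\<in>orthant. \<bar>V (f (k n)) x - v x\<bar> \<le> e / 2 * mass x)"
    using lim e by (meson half_gt_zero)
  have "near (f (k (Suc N))) (f (k N))"
    unfolding near_def
  proof (intro conjI ballI)
    show "\<bar>(\<Sum>t. f (k (Suc N)) t * r t) - (\<Sum>t. f (k N) t * r t)\<bar> \<le> e"
      using N[of N] N[of "Suc N"] by linarith
    fix x assume "x \<in> orthant"
    then have "\<bar>V (f (k N)) x - v x\<bar> \<le> e / 2 * mass x" "\<bar>V (f (k (Suc N))) x - v x\<bar> \<le> e / 2 * mass x"
      using N[of N] N[of "Suc N"] by auto
    then show "\<bar>V (f (k (Suc N))) x - V (f (k N)) x\<bar> \<le> e * mass x" by linarith
  qed
  moreover have "k N < k (Suc N)" using k by (simp add: strict_mono_def)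
  ultimately show False using f(2) by blast
qed

section \<open>Joint laws of state and history, and their one-step evolution\<close>

definition belief :: "'k pmf \<Rightarrow> real ^ 'k" where
  "belief p = (\<chi> k. pmf p k)"

text \<open>The unnormalised belief after \<open>h\<close>: its mass is the probability of
  \<open>h\<close>.\<close>

definition slice :: "('k \<times> 'h) pmf \<Rightarrow> 'h \<Rightarrow> real ^ 'k" where
  "slice z h = (\<chi> k. pmf z (k, h))"

text \<open>The expected continuation value once the history is known; by homogeneity of
  \<open>V\<close> the probability of each history is already included.\<close>

definition W :: "(nat \<Rightarrow> real) \<Rightarrow> ('k \<times> 'h) pmf \<Rightarrow> real" where
  "W \<theta> z = (\<Sum>h\<in>snd ` set_pmf z. V \<theta> (slice z h))"

text \<open>The recursion of \<open>state_hist\<close> with a decision rule for a single stage, so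
  that the rule can be chosen after the current law is known.\<close>

definition step :: "('k \<times> ('a \<times> 's) list) pmf \<Rightarrow> (('a \<times> 's) list \<Rightarrow> 'a pmf)
    \<Rightarrow> ('k \<times> ('a \<times> 's) list) pmf" where
  "step z \<beta> = bind_pmf z (\<lambda>(k, h).
       bind_pmf (\<beta> h) (\<lambda>a. map_pmf (\<lambda>(s, k'). (k', h @ [(a, s)])) (q k a)))"

lemma belief_orthant: "belief p \<in> orthant"
  and mass_belief: "mass (belief p) = 1"
  by (auto simp: belief_def orthant_def mass_def sum_pmf_eq_1)

lemma slice_orthant: "slice z h \<in> orthant"
  by (simp add: slice_def orthant_def)

lemma slice_eq_0: "h \<notin> snd ` set_pmf z \<Longrightarrow> slice z h = 0"
  by (force simp: slice_def vec_eq_iff pmf_eq_0_set_pmf)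

lemma mass_slices:
  assumes "finite (set_pmf z)"
  shows "(\<Sum>h\<in>snd ` set_pmf z. mass (slice z h)) = 1"
proof -
  have "(\<Sum>h\<in>snd ` set_pmf z. mass (slice z h)) = (\<Sum>x\<in>UNIV \<times> snd ` set_pmf z. pmf z x)"
    unfolding sum.cartesian_product' mass_def slice_def by (subst sum.swap) simp
  also have "\<dots> = 1" using assms by (intro sum_pmf_eq_1) force+
  finally show ?thesis .
qed

text \<open>The extended history determines \<open>h\<close>, \<open>a\<close> and \<open>s\<close>,
  so only pairs with old history \<open>h\<close> and only the action \<open>a\<close>
  contribute.\<close>

lemma pmf_step: "pmf (step z \<beta>) (k', h @ [(a, s)]) =
    pmf (\<beta> h) a * (\<Sum>k\<in>UNIV. pmf z (k, h) * pmf (q k a) (s, k'))"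
proof -
  have 1: "pmf (map_pmf (\<lambda>(s, k'). (k', h' @ [(a', s)])) (q k a')) (k', h @ [(a, s)]) =
      (if h' = h \<and> a' = a then pmf (q k a) (s, k') else 0)" for k h' a'
  proof (cases "h' = h \<and> a' = a")
    case True
    have "inj (\<lambda>(s, k'). (k', h @ [(a, s)]))" by (auto intro: injI)
    then show ?thesis using pmf_map_inj'[of "\<lambda>(s, k'). (k', h @ [(a, s)])" "q k a" "(s, k')"] True
      by simp
  next
    case False
    then have "(k', h @ [(a, s)]) \<notin> set_pmf (map_pmf (\<lambda>(s, k'). (k', h' @ [(a', s)])) (q k a'))"
      by auto
    then show ?thesis using False by (simp only: pmf_eq_0_set_pmf[symmetric] if_False)
  qed
  have 2: "pmf (bind_pmf (\<beta> h') (\<lambda>a. map_pmf (\<lambda>(s, k'). (k', h' @ [(a, s)])) (q k a))) (k', h @ [(a, s)]) =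
      (if h' = h then pmf (\<beta> h) a * pmf (q k a) (s, k') else 0)" for k h'
    unfolding pmf_bind 1 by (subst integral_measure_pmf_real[of "{a}"]) (auto split: if_splits)
  have "pmf (step z \<beta>) (k', h @ [(a, s)]) =
      measure_pmf.expectation z (\<lambda>x. if snd x = h then pmf (\<beta> h) a * pmf (q (fst x) a) (s, k') else 0)"
    unfolding step_def pmf_bind[of z]
    by (rule Bochner_Integration.integral_cong) (auto simp: 2)
  also have "\<dots> = (\<Sum>x\<in>UNIV \<times> {h}. (if snd x = h then pmf (\<beta> h) a * pmf (q (fst x) a) (s, k') else 0) * pmf z x)"
    by (rule integral_measure_pmf_real) (auto split: if_splits)
  also have "\<dots> = (\<Sum>k\<in>UNIV. pmf (\<beta> h) a * pmf (q k a) (s, k') * pmf z (k, h))"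
    unfolding sum.cartesian_product' by simp
  finally show ?thesis by (simp add: sum_distrib_left mult_ac)
qed

lemma slice_step: "slice (step z \<beta>) (h @ [(a, s)]) = pmf (\<beta> h) a *\<^sub>R push a s (slice z h)"
  by (simp add: slice_def push_def vec_eq_iff pmf_step)

lemma finite_set_step:
  "finite (set_pmf z) \<Longrightarrow> (\<And>h. finite (set_pmf (\<beta> h))) \<Longrightarrow> finite (set_pmf (step z \<beta>))"
  by (auto simp: step_def finite_q)

text \<open>New histories are indexed by triples \<open>(h, a, s)\<close>. Those of probability zero
  contribute \<open>V \<theta> 0 = 0\<close>, and homogeneity pulls out the probability of the
  action. The resulting expression is affine in each lottery \<open>\<beta> h\<close>, as the minmax
  argument requires.\<close>

lemma W_step:
  assumes z: "finite (set_pmf z)" and \<beta>: "\<And>h. finite (set_pmf (\<beta> h))" and \<theta>: "is_evaluation \<theta>"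
  shows "W \<theta> (step z \<beta>) = (\<Sum>h\<in>snd ` set_pmf z.
    measure_pmf.expectation (\<beta> h) (\<lambda>a. \<Sum>s\<in>signals a. V \<theta> (push a s (slice z h))))"
proof -
  let ?J = "SIGMA h : snd ` set_pmf z. SIGMA a : set_pmf (\<beta> h). signals a"
  let ?f = "\<lambda>(h, a, s). h @ [(a, s)]"
  have inj: "inj_on ?f ?J" by (auto simp: inj_on_def)
  have "W \<theta> (step z \<beta>) = (\<Sum>h\<in>?f ` ?J. V \<theta> (slice (step z \<beta>) h))"
    unfolding W_def
  proof (rule sum.mono_neutral_left)
    show "finite (?f ` ?J)" by (intro finite_imageI finite_SigmaI finite_signals \<beta> z)
    show "snd ` set_pmf (step z \<beta>) \<subseteq> ?f ` ?J"
      by (force simp: step_def signals_def)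
    show "\<forall>h\<in>?f ` ?J - snd ` set_pmf (step z \<beta>). V \<theta> (slice (step z \<beta>) h) = 0"
    proof
      fix h assume "h \<in> ?f ` ?J - snd ` set_pmf (step z \<beta>)"
      then have "slice (step z \<beta>) h = 0" by (intro slice_eq_0) blast
      then show "V \<theta> (slice (step z \<beta>) h) = 0" by (simp add: V_zero[OF \<theta>])
    qed
  qed
  also have "\<dots> = (\<Sum>(h, a, s)\<in>?J. V \<theta> (slice (step z \<beta>) (h @ [(a, s)])))"
    by (subst sum.reindex[OF inj]) (simp add: case_prod_unfold)
  also have "\<dots> = (\<Sum>(h, a, s)\<in>?J. pmf (\<beta> h) a * V \<theta> (push a s (slice z h)))"
    by (simp add: slice_step V_scale[OF \<theta>])
  also have "\<dots> = (\<Sum>h\<in>snd ` set_pmf z. \<Sum>a\<in>set_pmf (\<beta> h). \<Sum>s\<in>signals a.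
      pmf (\<beta> h) a * V \<theta> (push a s (slice z h)))"
    by (simp add: sum.Sigma[symmetric] z \<beta> finite_signals)
  also have "\<dots> = (\<Sum>h\<in>snd ` set_pmf z.
    measure_pmf.expectation (\<beta> h) (\<lambda>a. \<Sum>s\<in>signals a. V \<theta> (push a s (slice z h))))"
    by (intro sum.cong refl, subst integral_measure_pmf_real[OF \<beta>])
      (auto simp: sum_distrib_left mult.commute)
  finally show ?thesis .
qed

definition stage_gain :: "('k \<times> 'h) pmf \<Rightarrow> ('h \<Rightarrow> 'a pmf) \<Rightarrow> real" where
  "stage_gain z \<beta> = measure_pmf.expectation z (\<lambda>(k, h). measure_pmf.expectation (\<beta> h) (g k))"

text \<open>Brings the current payoff into the same form as \<open>W_step\<close>, a sum over
  histories that is affine in the lotteries.\<close>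

lemma stage_gain_eq:
  assumes z: "finite (set_pmf z)" and \<beta>: "\<And>h. finite (set_pmf (\<beta> h))"
  shows "stage_gain z \<beta> = (\<Sum>h\<in>snd ` set_pmf z.
    measure_pmf.expectation (\<beta> h) (\<lambda>a. \<Sum>k\<in>UNIV. slice z h $ k * g k a))"
proof -
  have "stage_gain z \<beta> = (\<Sum>x\<in>UNIV \<times> snd ` set_pmf z.
      (case x of (k, h) \<Rightarrow> measure_pmf.expectation (\<beta> h) (g k)) * pmf z x)"
    unfolding stage_gain_def using z by (intro integral_measure_pmf_real) force+
  also have "\<dots> = (\<Sum>k\<in>UNIV. \<Sum>h\<in>snd ` set_pmf z. measure_pmf.expectation (\<beta> h) (g k) * pmf z (k, h))"
    unfolding sum.cartesian_product' by simp
  also have "\<dots> = (\<Sum>h\<in>snd ` set_pmf z. \<Sum>k\<in>UNIV. measure_pmf.expectation (\<beta> h) (g k) * pmf z (k, h))"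
    by (rule sum.swap)
  finally show ?thesis
    by (simp add: slice_def integrable_measure_pmf_finite[OF \<beta>] mult.commute)
qed

lemma W_near:
  assumes z: "finite (set_pmf z)" and near: "\<And>x. x \<in> orthant \<Longrightarrow> \<bar>V \<theta> x - V \<theta>' x\<bar> \<le> e * mass x"
  shows "W \<theta>' z \<le> W \<theta> z + e"
proof -
  have "W \<theta>' z \<le> (\<Sum>h\<in>snd ` set_pmf z. V \<theta> (slice z h) + e * mass (slice z h))"
    unfolding W_def
  proof (rule sum_mono)
    fix h show "V \<theta>' (slice z h) \<le> V \<theta> (slice z h) + e * mass (slice z h)"
      using near[OF slice_orthant, of z h] by linarith
  qed
  also have "\<dots> = W \<theta> z + e"
    by (simp add: W_def sum.distrib sum_distrib_left[symmetric] mass_slices[OF z])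
  finally show ?thesis .
qed

text \<open>Keeps the first lottery of \<sigma> and bounds everything after it by the values, so
  that only \<open>\<sigma> []\<close> remains on the right.\<close>

lemma payoff_case_nat_le:
  assumes F: "finite F" "\<And>\<theta>. \<theta> \<in> F \<Longrightarrow> is_evaluation \<theta>" "\<And>\<theta>. \<theta> \<in> F \<Longrightarrow> 0 \<le> \<mu> \<theta>" and \<sigma>: "is_strategy \<sigma>"
  shows "payoff (case_nat m (\<lambda>t. \<Sum>\<theta>\<in>F. \<mu> \<theta> * \<theta> t)) \<sigma> x \<le>
    m * measure_pmf.expectation (\<sigma> []) (\<lambda>a. \<Sum>k\<in>UNIV. x $ k * g k a) +
    (\<Sum>\<theta>\<in>F. \<mu> \<theta> * measure_pmf.expectation (\<sigma> []) (\<lambda>a. \<Sum>s\<in>signals a. V \<theta> (push a s x)))"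
proof -
  have "reward_vec \<sigma> 0 x = measure_pmf.expectation (\<sigma> []) (\<lambda>a. \<Sum>k\<in>UNIV. x $ k * g k a)"
    by (simp add: reward_vec_def reward_def stage_payoff_def
        integrable_measure_pmf_finite[OF finite_strategy[OF \<sigma>]])
  moreover have "delayed_payoff 1 \<theta> \<sigma> x \<le>
      measure_pmf.expectation (\<sigma> []) (\<lambda>a. \<Sum>s\<in>signals a. V \<theta> (push a s x))" if "\<theta> \<in> F" for \<theta>
  proof -
    have "delayed_payoff 1 \<theta> \<sigma> x \<le> (\<Sum>a\<in>set_pmf (\<sigma> []). pmf (\<sigma> []) a * (\<Sum>s\<in>signals a. V \<theta> (push a s x)))"
      using delayed_payoff_Suc[OF F(2)[OF that] \<sigma>, of 0 x] F(2)[OF that] \<sigma>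
      by (auto intro!: sum_mono mult_left_mono payoff_le_V is_strategy_continuation)
    also have "\<dots> = measure_pmf.expectation (\<sigma> []) (\<lambda>a. \<Sum>s\<in>signals a. V \<theta> (push a s x))"
      by (subst integral_measure_pmf_real[OF finite_strategy[OF \<sigma>]]) (auto simp: mult.commute)
    finally show ?thesis .
  qed
  moreover have "payoff (case_nat m (\<lambda>t. \<Sum>\<theta>\<in>F. \<mu> \<theta> * \<theta> t)) \<sigma> x =
      m * reward_vec \<sigma> 0 x + (\<Sum>\<theta>\<in>F. \<mu> \<theta> * delayed_payoff 1 \<theta> \<sigma> x)"
    unfolding delayed_payoff_def
    using suminf_case_nat_evaluation[OF F(1,2), of "\<lambda>t. reward_vec \<sigma> t x", OF _ reward_vec_abs_le[OF \<sigma>]]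
    by simp
  ultimately show ?thesis using F(3) by (auto intro!: sum_mono mult_left_mono)
qed

text \<open>The minmax argument works because \<open>V\<close> is convex in the evaluation: a mixture of the
  constraints is implied by the constraint of the single evaluation \<open>\<xi>\<close> that puts weight
  \<open>\<mu> None\<close> on the current stage and mixes the remaining evaluations afterwards.\<close>
lemma one_step_realization:
  assumes z: "finite (set_pmf z)" and r: "\<And>t. \<bar>r t\<bar> \<le> 1" and e: "0 < e"
    and dom: "\<And>\<theta>. is_evaluation \<theta> \<Longrightarrow> (\<Sum>t. \<theta> t * r t) \<le> W \<theta> z + d"
  shows "\<exists>\<beta>. (\<forall>h. finite (set_pmf (\<beta> h))) \<and> r 0 \<le> stage_gain z \<beta> + d + e \<and>
    (\<forall>\<theta>. is_evaluation \<theta> \<longrightarrow> (\<Sum>t. \<theta> t * r (Suc t)) \<le> W \<theta> (step z \<beta>) + d + e)"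
proof -
  have e4: "0 < e / 4" using e by simp
  \<comment> \<open>The net turns the constraints into finitely many. It costs \<open>e / 4\<close>
    in the stream and \<open>e / 4\<close> in \<open>W\<close>, which together with the slack
    \<open>e / 2\<close> in \<open>f\<close> makes \<open>e\<close>.\<close>
  obtain F where F: "finite F" "\<And>\<theta>. \<theta> \<in> F \<Longrightarrow> is_evaluation \<theta>"
    and net: "\<And>\<theta>. is_evaluation \<theta> \<Longrightarrow> \<exists>\<theta>'\<in>F. \<bar>(\<Sum>t. \<theta> t * r (Suc t)) - (\<Sum>t. \<theta>' t * r (Suc t))\<bar> \<le> e / 4 \<and>
      (\<forall>x\<in>orthant. \<bar>V \<theta> x - V \<theta>' x\<bar> \<le> e / 4 * mass x)"
    using value_functions_net[of "e / 4" "\<lambda>t. r (Suc t)", OF e4 r] by blast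
  define H where "H = snd ` set_pmf z"
  have H: "finite H" using z by (simp add: H_def)
  define C where "C = {\<beta> :: ('a \<times> 's) list \<Rightarrow> 'a pmf. \<forall>h. finite (set_pmf (\<beta> h))}"
  \<comment> \<open>\<open>None\<close> stands for the payoff of the current stage,
    \<open>Some \<theta>\<close> for the continuation constraint of \<theta>.\<close>
  define \<Phi> where "\<Phi> i h = (case i of None \<Rightarrow> (\<lambda>a. \<Sum>k\<in>UNIV. slice z h $ k * g k a)
      | Some \<theta> \<Rightarrow> (\<lambda>a. \<Sum>s\<in>signals a. V \<theta> (push a s (slice z h))))" for i h
  define b where "b i = (case i of None \<Rightarrow> r 0 | Some \<theta> \<Rightarrow> \<Sum>t. \<theta> t * r (Suc t))" for i
  define E where "E i \<beta> = (\<Sum>h\<in>H. measure_pmf.expectation (\<beta> h) (\<Phi> i h))" for i \<beta>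
  define f where "f i \<beta> = E i \<beta> + (d + e / 2 - b i)" for i \<beta>
  define I where "I = insert None (Some ` F)"
  have I: "finite I" "I \<noteq> {}" using F by (auto simp: I_def)
  have E_None: "E None \<beta> = stage_gain z \<beta>" if "\<beta> \<in> C" for \<beta>
    using that by (simp add: stage_gain_eq[OF z] C_def E_def \<Phi>_def H_def)
  have E_Some: "E (Some \<theta>) \<beta> = W \<theta> (step z \<beta>)" if "\<beta> \<in> C" "is_evaluation \<theta>" for \<beta> \<theta>
    using that by (simp add: W_step[OF z] C_def E_def \<Phi>_def H_def)
  have "\<exists>\<beta>\<in>C. \<forall>i\<in>I. 0 < f i \<beta>"
  proof (rule ccontr)
    assume none: "\<not> ?thesis"
    have "\<exists>\<mu>. (\<forall>i\<in>I. 0 \<le> \<mu> i) \<and> sum \<mu> I = 1 \<and> (\<forall>y\<in>C. (\<Sum>i\<in>I. \<mu> i * f i y) \<le> 0)"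
    proof (rule finite_minmax_alternative[OF I _ none])
      fix y y' :: "('a \<times> 's) list \<Rightarrow> 'a pmf" and u :: real
      assume y: "y \<in> C" "y' \<in> C" and u: "0 \<le> u" "u \<le> 1"
      \<comment> \<open>A coin is tossed separately at each history; every \<open>E i\<close> is
        affine in each lottery, so it mixes exactly.\<close>
      let ?w = "\<lambda>h. bind_pmf (bernoulli_pmf u) (\<lambda>b. if b then y h else y' h)"
      have "E i ?w = u * E i y + (1 - u) * E i y'" for i
        using y u by (simp add: E_def C_def expectation_mixture sum.distrib sum_distrib_left)
      then have "f i ?w = u * f i y + (1 - u) * f i y'" for i
        by (simp add: f_def algebra_simps diff_divide_distrib)
      moreover have "?w \<in> C" using y by (auto simp: C_def)
      ultimately show "\<exists>w\<in>C. \<forall>i\<in>I. f i w = u * f i y + (1 - u) * f i y'" by blast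
    qed
    then obtain \<mu> where \<mu>: "\<And>i. i \<in> I \<Longrightarrow> 0 \<le> \<mu> i" "sum \<mu> I = 1" "\<And>y. y \<in> C \<Longrightarrow> (\<Sum>i\<in>I. \<mu> i * f i y) \<le> 0"
      by blast
    have sumI: "(\<Sum>i\<in>I. h i) = h None + (\<Sum>\<theta>\<in>F. h (Some \<theta>))" for h :: "_ \<Rightarrow> real"
      using F(1) by (simp add: I_def sum.reindex)
    define \<xi> where "\<xi> = case_nat (\<mu> None) (\<lambda>t. \<Sum>\<theta>\<in>F. \<mu> (Some \<theta>) * \<theta> t)"
    have \<xi>: "is_evaluation \<xi>"
      unfolding \<xi>_def using F \<mu>(1) \<mu>(2)[unfolded sumI]
      by (intro is_evaluation_case_nat) (auto simp: I_def)
    have \<xi>r: "(\<Sum>t. \<xi> t * r t) = (\<Sum>i\<in>I. \<mu> i * b i)"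
      unfolding \<xi>_def sumI b_def using suminf_case_nat_evaluation[OF F r] by simp
    define n where "n = real (card H) + 1"
    have n: "0 < n" by (simp add: n_def)
    have "\<exists>\<sigma>. is_strategy \<sigma> \<and> V \<xi> (slice z h) - e / 4 / n < payoff \<xi> \<sigma> (slice z h)" for h
      using V_approx[OF \<xi>] e4 n by simp
    then obtain \<tau> where \<tau>: "\<And>h. is_strategy (\<tau> h)"
      "\<And>h. V \<xi> (slice z h) - e / 4 / n < payoff \<xi> (\<tau> h) (slice z h)" by metis
    \<comment> \<open>Only the first lottery of each almost optimal strategy is kept.\<close>
    define \<beta> where "\<beta> h = \<tau> h []" for h
    have \<beta>: "\<beta> \<in> C" using finite_strategy[OF \<tau>(1)] by (simp add: C_def \<beta>_def)
    have "W \<xi> z \<le> (\<Sum>h\<in>H. payoff \<xi> (\<tau> h) (slice z h) + e / 4 / n)"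
      unfolding W_def H_def using \<tau>(2) by (intro sum_mono) (smt (verit))
    also have "\<dots> = (\<Sum>h\<in>H. payoff \<xi> (\<tau> h) (slice z h)) + real (card H) * (e / 4 / n)"
      by (simp add: sum.distrib)
    also have "real (card H) * (e / 4 / n) \<le> e / 4" using e n by (simp add: n_def field_simps)
    also have "(\<Sum>h\<in>H. payoff \<xi> (\<tau> h) (slice z h)) \<le>
        (\<Sum>h\<in>H. \<Sum>i\<in>I. \<mu> i * measure_pmf.expectation (\<beta> h) (\<Phi> i h))"
    proof (rule sum_mono)
      fix h
      show "payoff \<xi> (\<tau> h) (slice z h) \<le> (\<Sum>i\<in>I. \<mu> i * measure_pmf.expectation (\<beta> h) (\<Phi> i h))"
        unfolding \<xi>_def sumI \<Phi>_def \<beta>_def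
        using payoff_case_nat_le[OF F, of "\<lambda>\<theta>. \<mu> (Some \<theta>)" "\<tau> h" "\<mu> None" "slice z h"] \<tau>(1) \<mu>(1)
        by (simp add: I_def)
    qed
    also have "\<dots> = (\<Sum>i\<in>I. \<mu> i * E i \<beta>)"
      unfolding E_def sum_distrib_left by (rule sum.swap)
    finally have "W \<xi> z \<le> (\<Sum>i\<in>I. \<mu> i * E i \<beta>) + e / 4" by simp
    then have "(\<Sum>i\<in>I. \<mu> i * b i) \<le> (\<Sum>i\<in>I. \<mu> i * E i \<beta>) + e / 4 + d"
      using dom[OF \<xi>] unfolding \<xi>r by simp
    moreover have "(\<Sum>i\<in>I. \<mu> i * f i \<beta>) = (\<Sum>i\<in>I. \<mu> i * E i \<beta>) + (d + e / 2) - (\<Sum>i\<in>I. \<mu> i * b i)"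
    proof -
      have "(\<Sum>i\<in>I. \<mu> i * f i \<beta>) = (\<Sum>i\<in>I. \<mu> i * E i \<beta>) + (\<Sum>i\<in>I. \<mu> i) * (d + e / 2) - (\<Sum>i\<in>I. \<mu> i * b i)"
        unfolding f_def by (simp add: algebra_simps sum.distrib sum_subtractf sum_distrib_left)
      then show ?thesis using \<mu>(2) by simp
    qed
    \<comment> \<open>The slack \<open>e / 2\<close> exceeds the loss \<open>e / 4\<close>, so the
      weighted sum is positive.\<close>
    ultimately show False using \<mu>(3)[OF \<beta>] e by simp
  qed
  then obtain \<beta> where \<beta>: "\<beta> \<in> C" "\<And>i. i \<in> I \<Longrightarrow> 0 < f i \<beta>" by blast
  have fin: "\<forall>h. finite (set_pmf (\<beta> h))" using \<beta>(1) by (simp add: C_def)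
  have "r 0 \<le> stage_gain z \<beta> + d + e"
    using \<beta>(2)[of None] E_None[OF \<beta>(1)] e by (simp add: I_def f_def b_def)
  moreover have "(\<Sum>t. \<theta> t * r (Suc t)) \<le> W \<theta> (step z \<beta>) + d + e" if \<theta>: "is_evaluation \<theta>" for \<theta>
  proof -
    obtain \<theta>' where \<theta>': "\<theta>' \<in> F" "\<bar>(\<Sum>t. \<theta> t * r (Suc t)) - (\<Sum>t. \<theta>' t * r (Suc t))\<bar> \<le> e / 4"
      "\<forall>x\<in>orthant. \<bar>V \<theta> x - V \<theta>' x\<bar> \<le> e / 4 * mass x" using net[OF \<theta>] by blast
    have "(\<Sum>t. \<theta>' t * r (Suc t)) \<le> W \<theta>' (step z \<beta>) + d + e / 2"
      using \<beta>(2)[of "Some \<theta>'"] E_Some[OF \<beta>(1) F(2)[OF \<theta>'(1)]] \<theta>'(1) by (simp add: I_def f_def b_def)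
    moreover have "W \<theta>' (step z \<beta>) \<le> W \<theta> (step z \<beta>) + e / 4"
      using fin \<theta>'(3) by (intro W_near finite_set_step z) auto
    ultimately show ?thesis using \<theta>'(2) by linarith
  qed
  ultimately show ?thesis using fin by blast
qed

section \<open>Following a dominated stream, and choosing the stream\<close>

lemma length_state_hist: "(k, h) \<in> set_pmf (state_hist q p \<sigma> t) \<Longrightarrow> length h = t"
  by (induction t arbitrary: k h) auto

text \<open>\<open>one_step_realization\<close> is iterated along the shifted streams with
  geometrically decreasing errors. The laws \<open>z n\<close> are constructed first, and the
  strategy is read off from the decision rules that link them.\<close>

lemma realization:
  assumes r: "\<And>t. \<bar>r t\<bar> \<le> 1" and e: "0 < e"
    and dom: "\<And>\<theta>. is_evaluation \<theta> \<Longrightarrow> (\<Sum>t. \<theta> t * r t) \<le> V \<theta> (belief p)"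
  shows "\<exists>\<sigma>. is_strategy \<sigma> \<and> (\<forall>t. r t - e \<le> stage_payoff q g p \<sigma> t)"
proof -
  let ?z0 = "map_pmf (\<lambda>k. (k, [])) p :: ('k \<times> ('a \<times> 's) list) pmf"
  \<comment> \<open>The error accumulated before stage \<open>n\<close>, a partial sum of
    \<open>e / 2 ^ (i + 1)\<close>.\<close>
  define d where "d n = e * (1 - (1/2) ^ n)" for n :: nat
  \<comment> \<open>The clause for \<open>n = 0\<close> pins the chosen sequence of laws to the
    actual initial law.\<close>
  define P where "P n z \<longleftrightarrow> finite (set_pmf z) \<and> (n = 0 \<longrightarrow> z = ?z0) \<and>
      (\<forall>\<theta>. is_evaluation \<theta> \<longrightarrow> (\<Sum>t. \<theta> t * r (t + n)) \<le> W \<theta> z + d n)" for n z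
  define Q where "Q n z z' \<longleftrightarrow> (\<exists>\<beta>. (\<forall>h. finite (set_pmf (\<beta> h))) \<and> r n - e \<le> stage_gain z \<beta> \<and>
      z' = step z \<beta>)" for n z z'
  have "\<exists>f. \<forall>n. P n (f n) \<and> Q n (f n) (f (Suc n))"
  proof (rule dependent_nat_choice)
    have "snd ` set_pmf ?z0 = {[]}" using set_pmf_not_empty[of p] by (auto simp: image_image)
    moreover have "slice ?z0 [] = belief p"
      using pmf_map_inj'[of "\<lambda>k. (k, [] :: ('a \<times> 's) list)" p]
      by (simp add: slice_def belief_def vec_eq_iff inj_on_def)
    ultimately have "W \<theta> ?z0 = V \<theta> (belief p)" for \<theta> by (simp add: W_def)
    then show "\<exists>z. P 0 z" using dom by (intro exI[of _ ?z0]) (simp add: P_def d_def)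
  next
    fix z n assume Pz: "P n z"
    define c where "c = e * (1/2) ^ Suc n"
    have c: "0 < c" using e by (simp add: c_def)
    have dc: "d n + c = d (Suc n)" by (simp add: d_def c_def algebra_simps)
    have de: "d (Suc n) \<le> e" using e by (simp add: d_def algebra_simps)
    have "\<exists>\<beta>. (\<forall>h. finite (set_pmf (\<beta> h))) \<and> r (0 + n) \<le> stage_gain z \<beta> + d n + c \<and>
      (\<forall>\<theta>. is_evaluation \<theta> \<longrightarrow> (\<Sum>t. \<theta> t * r (Suc t + n)) \<le> W \<theta> (step z \<beta>) + d n + c)"
      using Pz r c by (intro one_step_realization) (auto simp: P_def)
    then obtain \<beta> where \<beta>: "\<forall>h. finite (set_pmf (\<beta> h))" "r n \<le> stage_gain z \<beta> + d n + c"
      "\<forall>\<theta>. is_evaluation \<theta> \<longrightarrow> (\<Sum>t. \<theta> t * r (t + Suc n)) \<le> W \<theta> (step z \<beta>) + d n + c" by auto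
    have "P (Suc n) (step z \<beta>)"
      using \<beta> Pz dc by (auto simp: P_def add.assoc intro!: finite_set_step)
    moreover have "Q n z (step z \<beta>)"
      unfolding Q_def using \<beta>(1,2) dc de by (intro exI[of _ \<beta>]) auto
    ultimately show "\<exists>z'. P (Suc n) z' \<and> Q n z z'" by blast
  qed
  then obtain z where z: "\<And>n. P n (z n)" "\<And>n. Q n (z n) (z (Suc n))" by blast
  then obtain \<beta> where \<beta>: "\<And>n h. finite (set_pmf (\<beta> n h))" "\<And>n. r n - e \<le> stage_gain (z n) (\<beta> n)"
    "\<And>n. z (Suc n) = step (z n) (\<beta> n)" unfolding Q_def by metis
  \<comment> \<open>The length of a history gives its stage, so the rules of all stages fit into one
    strategy.\<close>
  define \<sigma> where "\<sigma> h = \<beta> (length h) h" for h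
  have \<sigma>: "is_strategy \<sigma>" using \<beta>(1) by (simp add: is_strategy_def \<sigma>_def)
  have hist: "state_hist q p \<sigma> t = z t" for t
  proof (induction t)
    case 0
    then show ?case using z(1)[of 0] by (simp add: P_def)
  next
    case (Suc t)
    have "state_hist q p \<sigma> (Suc t) = step (state_hist q p \<sigma> t) (\<beta> t)"
      unfolding step_def state_hist.simps
      by (rule bind_pmf_cong[OF refl]) (auto simp: \<sigma>_def dest: length_state_hist)
    then show ?case by (simp add: Suc \<beta>(3))
  qed
  have "stage_payoff q g p \<sigma> t = stage_gain (z t) (\<beta> t)" for t
    unfolding stage_payoff_def stage_gain_def hist[symmetric]
    by (rule integral_cong_AE) (auto simp: AE_measure_pmf_iff \<sigma>_def dest: length_state_hist)
  then show ?thesis using \<sigma> \<beta>(2) by auto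
qed

text \<open>By compactness it suffices to meet finitely many lower bounds at once. If this were
  impossible, the minmax alternative would produce one mixed bound that fails for all dominated
  streams, although an almost optimal strategy for the mixed evaluation meets it.\<close>

lemma guaranteed_payoff_stream:
  assumes x: "x \<in> orthant" "mass x = 1" and d: "0 < d"
    and c: "\<And>\<theta>. is_evaluation \<theta> \<Longrightarrow> TV \<theta> \<le> \<alpha> \<Longrightarrow> c \<le> V \<theta> x"
  shows "\<exists>r. (\<forall>t. 0 \<le> r t \<and> r t \<le> 1) \<and> (\<forall>\<theta>. is_evaluation \<theta> \<longrightarrow> (\<Sum>t. \<theta> t * r t) \<le> V \<theta> x) \<and>
    (\<forall>\<theta>. is_evaluation \<theta> \<longrightarrow> TV \<theta> \<le> \<alpha> \<longrightarrow> c - d \<le> (\<Sum>t. \<theta> t * r t))"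
proof -
  let ?B = "UNIV \<rightarrow> {0..1} :: (nat \<Rightarrow> real) set"
  have closed: "closed ?B" using compact_box by (rule compact_imp_closed)
  \<comment> \<open>A compact convex set of streams that contains the payoff stream of every
    strategy.\<close>
  define S where "S = ?B \<inter> (\<Inter>\<theta>\<in>{\<theta>. is_evaluation \<theta>}. {r\<in>?B. (\<Sum>t. \<theta> t * r t) \<le> V \<theta> x})"
  define T where "T \<theta> = {r\<in>?B. c - d \<le> (\<Sum>t. \<theta> t * r t)}" for \<theta>
  let ?\<Theta> = "{\<theta>. is_evaluation \<theta> \<and> TV \<theta> \<le> \<alpha>}"
  have bnd: "\<bar>r t\<bar> \<le> 1" if "r \<in> ?B" for r t using that by (auto simp: Pi_iff)
  have S_iff: "r \<in> S \<longleftrightarrow> r \<in> ?B \<and> (\<forall>\<theta>. is_evaluation \<theta> \<longrightarrow> (\<Sum>t. \<theta> t * r t) \<le> V \<theta> x)" for r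
    by (auto simp: S_def)
  have S_strategy: "(\<lambda>t. reward_vec \<sigma> t x) \<in> S" if "is_strategy \<sigma>" for \<sigma>
    using that reward_vec_bounds[OF that x(1)] x(2) payoff_le_V[OF _ that, of _ x]
    by (auto simp: S_iff delayed_payoff_def)
  have "S \<inter> (\<Inter>\<theta>\<in>?\<Theta>. T \<theta>) \<noteq> {}"
  proof (rule compact_imp_fip_image)
    show "compact S" unfolding S_def
      by (intro compact_Int_closed compact_box closed_INT ballI continuous_on_closed_Collect_le
          continuous_on_evaluation continuous_on_const closed) auto
    show "closed (T \<theta>)" if "\<theta> \<in> ?\<Theta>" for \<theta> unfolding T_def
      using that by (intro continuous_on_closed_Collect_le continuous_on_evaluation
          continuous_on_const closed) auto
    fix I assume I: "finite I" "I \<subseteq> ?\<Theta>"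
    then have ev: "\<And>\<theta>. \<theta> \<in> I \<Longrightarrow> is_evaluation \<theta>" "\<And>\<theta>. \<theta> \<in> I \<Longrightarrow> TV \<theta> \<le> \<alpha>" by auto
    show "S \<inter> (\<Inter>\<theta>\<in>I. T \<theta>) \<noteq> {}"
    proof (cases "I = {}")
      case True
      then show ?thesis using S_strategy strategy_exists by auto
    next
      case False
      define f where "f \<theta> r = (\<Sum>t. \<theta> t * r t) - (c - d)" for \<theta> r :: "nat \<Rightarrow> real"
      have "\<exists>r\<in>S. \<forall>\<theta>\<in>I. 0 < f \<theta> r"
      proof (rule ccontr)
        assume none: "\<not> ?thesis"
        have "\<exists>\<mu>. (\<forall>\<theta>\<in>I. 0 \<le> \<mu> \<theta>) \<and> sum \<mu> I = 1 \<and> (\<forall>r\<in>S. (\<Sum>\<theta>\<in>I. \<mu> \<theta> * f \<theta> r) \<le> 0)"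
        proof (rule finite_minmax_alternative[OF I(1) False _ none])
          fix y y' u assume y: "y \<in> S" "y' \<in> S" and u: "0 \<le> (u::real)" "u \<le> 1"
          let ?w = "\<lambda>t. u * y t + (1 - u) * y' t"
          have B: "y \<in> ?B" "y' \<in> ?B" using y by (auto simp: S_iff)
          have eq: "(\<Sum>t. \<theta> t * ?w t) = u * (\<Sum>t. \<theta> t * y t) + (1 - u) * (\<Sum>t. \<theta> t * y' t)"
            if "is_evaluation \<theta>" for \<theta>
          proof -
            have s: "summable (\<lambda>t. \<theta> t * y t)" "summable (\<lambda>t. \<theta> t * y' t)"
              using evaluation_summable_mult[OF that, of y 1] evaluation_summable_mult[OF that, of y' 1]
                bnd B by auto
            have "(\<Sum>t. \<theta> t * ?w t) = (\<Sum>t. u * (\<theta> t * y t) + (1 - u) * (\<theta> t * y' t))"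
              by (simp add: algebra_simps)
            also have "\<dots> = (\<Sum>t. u * (\<theta> t * y t)) + (\<Sum>t. (1 - u) * (\<theta> t * y' t))"
              by (intro suminf_add[symmetric] summable_mult s)
            finally show ?thesis by (simp add: suminf_mult s)
          qed
          have "?w \<in> ?B"
          proof
            fix t
            have yt: "0 \<le> y t" "y t \<le> 1" "0 \<le> y' t" "y' t \<le> 1" using B by (auto simp: Pi_iff)
            then show "?w t \<in> {0..1}" using u convex_bound_le[of "y t" 1 "y' t" u "1 - u"] by simp
          qed
          moreover have "(\<Sum>t. \<theta> t * ?w t) \<le> V \<theta> x" if "is_evaluation \<theta>" for \<theta>
            unfolding eq[OF that] using y that u by (intro convex_bound_le) (auto simp: S_iff)
          ultimately have "?w \<in> S" by (simp add: S_iff)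
          moreover have "f \<theta> ?w = u * f \<theta> y + (1 - u) * f \<theta> y'" if "\<theta> \<in> I" for \<theta>
            unfolding f_def eq[OF ev(1)[OF that]] by (simp add: algebra_simps)
          ultimately show "\<exists>w\<in>S. \<forall>\<theta>\<in>I. f \<theta> w = u * f \<theta> y + (1 - u) * f \<theta> y'" by blast
        qed
        then obtain \<mu> where \<mu>: "\<And>\<theta>. \<theta> \<in> I \<Longrightarrow> 0 \<le> \<mu> \<theta>" "sum \<mu> I = 1"
          "\<And>r. r \<in> S \<Longrightarrow> (\<Sum>\<theta>\<in>I. \<mu> \<theta> * f \<theta> r) \<le> 0" by blast
        \<comment> \<open>The weighted constraints amount to the single constraint of \<xi>, whose
          variation is again at most \<alpha>, so the hypothesis on \<open>c\<close> applies to
          it.\<close>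
        define \<xi> where "\<xi> t = (\<Sum>\<theta>\<in>I. \<mu> \<theta> * \<theta> t)" for t
        have \<xi>: "is_evaluation \<xi>" "TV \<xi> \<le> \<alpha>"
          unfolding \<xi>_def using evaluation_convex_sum[OF I(1), of "\<lambda>\<theta>. \<theta>" \<mu>]
            TV_convex_sum_le[OF I(1), of "\<lambda>\<theta>. \<theta>" \<mu> \<alpha>] ev \<mu>(1,2) by auto
        obtain \<sigma> where \<sigma>: "is_strategy \<sigma>" "V \<xi> x - d < payoff \<xi> \<sigma> x" using V_approx[OF \<xi>(1) d] by blast
        let ?r = "\<lambda>t. reward_vec \<sigma> t x"
        have rS: "?r \<in> S" using S_strategy[OF \<sigma>(1)] .
        have "payoff \<xi> \<sigma> x = (\<Sum>t. \<Sum>\<theta>\<in>I. \<mu> \<theta> * (\<theta> t * ?r t))"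
          by (simp add: delayed_payoff_def \<xi>_def sum_distrib_right mult.assoc)
        also have "\<dots> = (\<Sum>\<theta>\<in>I. \<Sum>t. \<mu> \<theta> * (\<theta> t * ?r t))"
          using summable_reward_vec[OF ev(1) \<sigma>(1), of _ 0] by (intro suminf_sum summable_mult) simp
        also have "\<dots> = (\<Sum>\<theta>\<in>I. \<mu> \<theta> * (\<Sum>t. \<theta> t * ?r t))"
          using summable_reward_vec[OF ev(1) \<sigma>(1), of _ 0] by (intro sum.cong refl suminf_mult) simp
        finally have "(\<Sum>\<theta>\<in>I. \<mu> \<theta> * f \<theta> ?r) = payoff \<xi> \<sigma> x - sum \<mu> I * (c - d)"
          by (simp add: f_def right_diff_distrib sum_subtractf sum_distrib_right)
        then show False using \<mu>(2) \<mu>(3)[OF rS] \<sigma>(2) c[OF \<xi>] by simp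
      qed
      then obtain r where "r \<in> S" "\<forall>\<theta>\<in>I. 0 < f \<theta> r" by blast
      then have "r \<in> S \<inter> (\<Inter>\<theta>\<in>I. T \<theta>)" by (auto simp: T_def f_def S_iff)
      then show ?thesis by blast
    qed
  qed
  then obtain r where "r \<in> S" "\<forall>\<theta>\<in>?\<Theta>. r \<in> T \<theta>" by blast
  then show ?thesis by (intro exI[of _ r]) (auto simp: S_iff T_def Pi_iff)
qed

section \<open>Return to initial probabilities and assembly of the result\<close>

lemma gamma_eq_payoff: "is_strategy \<sigma> \<Longrightarrow> gamma q g \<theta> p \<sigma> = payoff \<theta> \<sigma> (belief p)"
  by (simp add: gamma_def delayed_payoff_def reward_vec_def belief_def stage_payoff_mixture)

lemma val_eq_V: "val q g \<theta> p = V \<theta> (belief p)"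
  unfolding val_def V_def by (rule SUP_cong) (auto simp: gamma_eq_payoff)

theorem general_uniform_value:
  "\<exists>v. \<forall>\<epsilon>>0. \<exists>\<alpha>>0. \<exists>\<sigma>. (\<forall>p. is_strategy (\<sigma> p)) \<and> (\<forall>\<theta> p. is_evaluation \<theta> \<and> TV \<theta> \<le> \<alpha> \<longrightarrow>
     \<bar>val q g \<theta> p - v p\<bar> \<le> \<epsilon> \<and> v p - \<epsilon> \<le> gamma q g \<theta> p (\<sigma> p))"
proof -
  obtain v where v: "\<And>e. 0 < e \<Longrightarrow> \<exists>\<alpha>>0. \<forall>\<theta>. is_evaluation \<theta> \<longrightarrow> TV \<theta> \<le> \<alpha> \<longrightarrow>
      (\<forall>x\<in>orthant. \<bar>V \<theta> x - v x\<bar> \<le> e * mass x)"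
    using value_convergence by blast
  show ?thesis
  proof (intro exI[of _ "\<lambda>p. v (belief p)"] allI impI)
    fix \<epsilon> :: real assume "0 < \<epsilon>"
    \<comment> \<open>One third for the distance between \<open>V\<close> and \<open>v\<close>, one
      for the choice of the stream \<open>r\<close>, one for its realisation.\<close>
    define e where "e = \<epsilon> / 3"
    have e: "0 < e" using \<open>0 < \<epsilon>\<close> by (simp add: e_def)
    obtain \<alpha> where \<alpha>: "0 < \<alpha>" and close: "\<And>\<theta> x. is_evaluation \<theta> \<Longrightarrow> TV \<theta> \<le> \<alpha> \<Longrightarrow> x \<in> orthant \<Longrightarrow>
        \<bar>V \<theta> x - v x\<bar> \<le> e * mass x" using v[OF e] by blast
    have near: "\<bar>V \<theta> (belief p) - v (belief p)\<bar> \<le> e" if "is_evaluation \<theta>" "TV \<theta> \<le> \<alpha>" for \<theta> p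
      using close[OF that belief_orthant, of p] by (simp add: mass_belief)
    have "\<exists>\<sigma>. is_strategy \<sigma> \<and> (\<forall>\<theta>. is_evaluation \<theta> \<and> TV \<theta> \<le> \<alpha> \<longrightarrow>
        v (belief p) - \<epsilon> \<le> gamma q g \<theta> p \<sigma>)" for p
    proof -
      have "v (belief p) - e \<le> V \<theta> (belief p)" if "is_evaluation \<theta>" "TV \<theta> \<le> \<alpha>" for \<theta>
        using near[OF that, of p] by simp
      then obtain r where r: "\<And>t. 0 \<le> r t \<and> r t \<le> 1"
        "\<And>\<theta>. is_evaluation \<theta> \<Longrightarrow> (\<Sum>t. \<theta> t * r t) \<le> V \<theta> (belief p)"
        "\<And>\<theta>. is_evaluation \<theta> \<Longrightarrow> TV \<theta> \<le> \<alpha> \<Longrightarrow> v (belief p) - e - e \<le> (\<Sum>t. \<theta> t * r t)"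
        using guaranteed_payoff_stream[OF belief_orthant mass_belief e, of \<alpha> "v (belief p) - e" p] by blast
      have r1: "\<bar>r t\<bar> \<le> 1" for t using r(1)[of t] by simp
      \<comment> \<open>The strategy follows \<open>r\<close> stage by stage, hence it is good for
        all slowly varying evaluations simultaneously.\<close>
      obtain \<sigma> where \<sigma>: "is_strategy \<sigma>" "\<And>t. r t - e \<le> stage_payoff q g p \<sigma> t"
        using realization[OF r1 e r(2)] by blast
      have "v (belief p) - \<epsilon> \<le> gamma q g \<theta> p \<sigma>" if \<theta>: "is_evaluation \<theta>" "TV \<theta> \<le> \<alpha>" for \<theta>
      proof -
        have sp: "stage_payoff q g p \<sigma> t = reward_vec \<sigma> t (belief p)" for t
          by (simp add: stage_payoff_mixture[OF \<sigma>(1)] reward_vec_def belief_def)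
        have s1: "summable (\<lambda>t. \<theta> t * stage_payoff q g p \<sigma> t)"
          unfolding sp using summable_reward_vec[OF \<theta>(1) \<sigma>(1), of 0] by simp
        have s2: "summable (\<lambda>t. \<theta> t * r t)" by (rule evaluation_summable_mult[OF \<theta>(1) r1])
        have "(\<Sum>t. \<theta> t * r t) - (\<Sum>t. \<theta> t * stage_payoff q g p \<sigma> t) =
            (\<Sum>t. \<theta> t * (r t - stage_payoff q g p \<sigma> t))"
          using suminf_diff[OF s2 s1] by (simp add: right_diff_distrib)
        also have "\<dots> \<le> e"
        proof (rule evaluation_suminf_mult_le[OF \<theta>(1)])
          show "\<bar>r t - stage_payoff q g p \<sigma> t\<bar> \<le> 1" for t
            using r(1)[of t] reward_vec_bounds(1,2)[OF \<sigma>(1) belief_orthant, of t p]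
            by (simp add: sp mass_belief abs_le_iff)
          show "r t - stage_payoff q g p \<sigma> t \<le> e" for t using \<sigma>(2)[of t] by simp
        qed
        finally show ?thesis using r(3)[OF \<theta>] by (simp add: gamma_def e_def)
      qed
      then show ?thesis using \<sigma>(1) by blast
    qed
    then obtain \<sigma> where "\<And>p. is_strategy (\<sigma> p)" "\<And>p \<theta>. is_evaluation \<theta> \<Longrightarrow> TV \<theta> \<le> \<alpha> \<Longrightarrow>
        v (belief p) - \<epsilon> \<le> gamma q g \<theta> p (\<sigma> p)" by metis
    moreover have "\<bar>val q g \<theta> p - v (belief p)\<bar> \<le> \<epsilon>" if "is_evaluation \<theta>" "TV \<theta> \<le> \<alpha>" for \<theta> p
      using near[OF that, of p] e by (simp add: val_eq_V e_def)
    ultimately show "\<exists>\<alpha>>0. \<exists>\<sigma>. (\<forall>p. is_strategy (\<sigma> p)) \<and> (\<forall>\<theta> p. is_evaluation \<theta> \<and> TV \<theta> \<le> \<alpha> \<longrightarrow>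
        \<bar>val q g \<theta> p - v (belief p)\<bar> \<le> \<epsilon> \<and> v (belief p) - \<epsilon> \<le> gamma q g \<theta> p (\<sigma> p))"
      using \<alpha> by blast
  qed
qed

end

theorem theorem5:
  fixes q :: "'k::finite \<Rightarrow> 'a \<Rightarrow> ('s \<times> 'k) pmf"
    and g :: "'k \<Rightarrow> 'a \<Rightarrow> real"
  assumes "\<And>k a. finite (set_pmf (q k a))"
    and "\<And>k a. 0 \<le> g k a \<and> g k a \<le> 1"
  shows "\<exists>v :: 'k pmf \<Rightarrow> real. \<forall>\<epsilon>>0. \<exists>\<alpha>>0. \<exists>\<sigma> :: 'k pmf \<Rightarrow> (('a \<times> 's) list \<Rightarrow> 'a pmf).
           (\<forall>p. is_strategy (\<sigma> p)) \<and>
           (\<forall>\<theta> p. is_evaluation \<theta> \<and> TV \<theta> \<le> \<alpha> \<longrightarrow>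
                 \<bar>val q g \<theta> p - v p\<bar> \<le> \<epsilon> \<and> gamma q g \<theta> p (\<sigma> p) \<ge> v p - \<epsilon>)"
proof -
  interpret pomdp q g by standard (use assms in auto)
  show ?thesis by (rule general_uniform_value)
qed

end
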